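(* For every finite set $\mathcal A\subset\mathbb{R}^d$ and every sequence $\{w_i\mid i\in\mathbb{N}\}$ in $\mathbb{R}^{\mathcal A}_>$, there exist a subsequence $\{u_j\mid j\in\mathbb{N}\}$ of $\{w_i\}$, a regular subdivision $\mathcal S$ of $\mathcal A$, and $w\in\mathbb{R}^{\mathcal A}_>$ such that $\lim_{j\to\infty}u_j.X_{\mathcal A}=X(\mathcal S,w)$ in the Hausdorff topology on closed subsets of $\Delta^{\mathcal A}$.
   Context: $\Delta^{\mathcal A}=\{z\in\mathbb{R}_{\ge0}^{\mathcal A}\mid\sum_{\mathbf a}z_{\mathbf a}=1\}$, with homogeneous coordinates $[z_{\mathbf a}\mid\mathbf a\in\mathcal A]$ and the $\ell_1$ metric; the Hausdorff distance between closed sets $X,Y$ is $\max\{\sup_{x\in X}\inf_{y\in Y}d(x,y),\sup_{y\in Y}\inf_{x\in X}d(x,y)\}$. For $\mathcal F\subset\mathcal A$, $\Delta^{\mathcal F}$ is the face of $\Delta^{\mathcal A}$ with $z_{\mathbf a}=0$ for $\mathbf a\notin\mathcal F$. For $x\in\mathbb{R}^d_>$, $x^{\mathbf a}=\prod_j\exp(\mathbf a_j\log x_j)$. The real irrational toric variety $X_{\mathcal A}$ is the closure of $\{[x^{\mathbf a}\mid\mathbf a\in\mathcal A]\mid x\in\mathbb{R}^d_>\}$ in $\Delta^{\mathcal A}$; $u\in\mathbb{R}^{\mathcal A}_>$ acts by $u.z=[u_{\mathbf a}z_{\mathbf a}]$. For $w\in\mathbb{R}^{\mathcal A}_>$ and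 $\mathcal F\subset\mathcal A$, $X_{\mathcal F,w}$ is the closure in $\Delta^{\mathcal F}$ of $\{[w_{\mathbf f}x^{\mathbf f}\mid\mathbf f\in\mathcal F]\mid x\in\mathbb{R}^d_>\}$. A regular subdivision of $\mathcal A$ is one of the form $\mathcal S_\lambda$, $\lambda\in\mathbb{R}^{\mathcal A}$: with $P_\lambda=\mathrm{conv}\{(\mathbf a,\lambda(\mathbf a))\}$, whose upper faces are the faces with an outward normal having positive last coordinate, the faces of $\mathcal S_\lambda$ are the sets $\{\mathbf a\mid(\mathbf a,\lambda(\mathbf a))\in F\}$ for upper faces $F$. The complex of toric varieties is $X(\mathcal S,w)=\bigcup_{\mathcal F\text{ a face of }\mathcal S}X_{\mathcal F,w}$. *)

theory Defs
  imports "HOL-Analysis.Analysis"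
begin

text \<open>Points of R^d are elements of real^'d. A finite configuration A is a finite set of
such points; elements of R^A (and of the simplex) are functions real^'d => real, where
only the values on A matter (points of the simplex are zero outside their support set).\<close>

definition simplexA :: "(real^'d) set \<Rightarrow> ((real^'d) \<Rightarrow> real) set" where
  "simplexA F = {z. (\<forall>a\<in>F. 0 \<le> z a) \<and> (\<forall>a. a \<notin> F \<longrightarrow> z a = 0) \<and> sum z F = 1}"

text \<open>Homogeneous coordinates [v_a | a in F] (for v positive on F).\<close>
definition hom :: "(real^'d) set \<Rightarrow> ((real^'d) \<Rightarrow> real) \<Rightarrow> ((real^'d) \<Rightarrow> real)" where
  "hom F v = (\<lambda>a. if a \<in> F then v a / sum v F else 0)"

definition l1dist :: "(real^'d) set \<Rightarrow> ((real^'d) \<Rightarrow> real) \<Rightarrow> ((real^'d) \<Rightarrow> real) \<Rightarrow> real" where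
  "l1dist A z y = (\<Sum>a\<in>A. \<bar>z a - y a\<bar>)"

text \<open>Hausdorff distance w.r.t. the l1 metric (empty sets: distance 0, as in the library's hausdist).\<close>
definition hdistA :: "(real^'d) set \<Rightarrow> ((real^'d) \<Rightarrow> real) set \<Rightarrow> ((real^'d) \<Rightarrow> real) set \<Rightarrow> real" where
  "hdistA A X Y = (if X = {} \<or> Y = {} then 0 else
     max (SUP x\<in>X. INF y\<in>Y. l1dist A x y) (SUP y\<in>Y. INF x\<in>X. l1dist A x y))"

definition monom_pt :: "real^'d \<Rightarrow> real^'d \<Rightarrow> real" where
  "monom_pt x a = (\<Prod>j\<in>UNIV. exp (a $ j * ln (x $ j)))"

definition toric :: "(real^'d) set \<Rightarrow> ((real^'d) \<Rightarrow> real) \<Rightarrow> (real^'d) set \<Rightarrow> ((real^'d) \<Rightarrow> real) set" where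
  "toric A w F = simplexA F \<inter>
     {z. \<forall>e>0. \<exists>y\<in>{hom F (\<lambda>f. w f * monom_pt x f) | x. \<forall>j. 0 < x $ j}. l1dist A z y < e}"

definition toric_var :: "(real^'d) set \<Rightarrow> ((real^'d) \<Rightarrow> real) set" where
  "toric_var A = toric A (\<lambda>_. 1) A"

definition act :: "(real^'d) set \<Rightarrow> ((real^'d) \<Rightarrow> real) \<Rightarrow> ((real^'d) \<Rightarrow> real) \<Rightarrow> ((real^'d) \<Rightarrow> real)" where
  "act A u z = hom A (\<lambda>a. u a * z a)"

definition liftP :: "(real^'d) set \<Rightarrow> ((real^'d) \<Rightarrow> real) \<Rightarrow> ((real^'d) \<times> real) set" where
  "liftP A lam = convex hull ((\<lambda>a. (a, lam a)) ` A)"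

definition upper_face :: "(real^'d) set \<Rightarrow> ((real^'d) \<Rightarrow> real) \<Rightarrow> ((real^'d) \<times> real) set \<Rightarrow> bool" where
  "upper_face A lam F \<longleftrightarrow> F face_of liftP A lam \<and>
     (\<exists>c t. t > 0 \<and> F = {p \<in> liftP A lam. \<forall>q \<in> liftP A lam. inner (c, t) q \<le> inner (c, t) p})"

definition reg_subdiv :: "(real^'d) set \<Rightarrow> ((real^'d) \<Rightarrow> real) \<Rightarrow> (real^'d) set set" where
  "reg_subdiv A lam = {{a \<in> A. (a, lam a) \<in> F} | F. upper_face A lam F}"

definition is_regular_subdivision :: "(real^'d) set \<Rightarrow> (real^'d) set set \<Rightarrow> bool" where
  "is_regular_subdivision A S \<longleftrightarrow> (\<exists>lam. S = reg_subdiv A lam)"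

definition toric_complex :: "(real^'d) set \<Rightarrow> (real^'d) set set \<Rightarrow> ((real^'d) \<Rightarrow> real) \<Rightarrow> ((real^'d) \<Rightarrow> real) set" where
  "toric_complex A S w = (\<Union>F\<in>S. toric A w F)"

end

theory Submission
  imports Defs "HOL-Real_Asymp.Real_Asymp"
begin

text \<open>
  Work with v = ln w and parametrise the torus orbits by y = ln x. Call G an asymptotic face of a
  sequence v if for suitable y, c the numbers v + <a, y> - c stay bounded on G and tend to minus
  infinity off G; these G are exactly the supports of limits of points of the deformed varieties.
  Pass to a subsequence whose set of asymptotic faces is maximal, so that no further subsequence
  has new ones. Boundedness conditions that are linear can be made exact by a bounded correction,
  so v = lam + e with e bounded and lam affine on every asymptotic face. After one more
  subsequence e converges to some limit and the regular subdivision S induced by lam is constant.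
  Asymptotic faces lie in S by construction; conversely a face F of S lies in an asymptotic face G,
  is cut out of it by a fixed linear functional, and adding a slowly diverging multiple of that
  functional exhibits F as an asymptotic face. With w = exp (lim e) the Hausdorff limit
  is then the complex of S and w.
\<close>

section \<open>Sequences\<close>

text \<open>Induction on the functionals. If the new \<open>\<phi>\<close> agrees on
  \<open>e i\<close> and \<open>x i\<close> for every i, \<open>e\<close> is kept. Otherwise one
  fixed difference \<open>z j\<close>, on which the old functionals vanish, corrects all indices at
  once with bounded coefficients.\<close>

lemma bounded_linear_lift:
  fixes x :: "nat \<Rightarrow> 'k \<Rightarrow> 'b::real_normed_vector" and \<Phi> :: "(('k \<Rightarrow> 'b) \<Rightarrow> real) set"
  assumes "finite \<Phi>"
    and lin: "\<And>\<phi> u s z. \<phi> \<in> \<Phi> \<Longrightarrow> \<phi> (\<lambda>k. u k + s *\<^sub>R z k) = \<phi> u + s * \<phi> z"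
    and bnd: "\<And>\<phi> e. \<phi> \<in> \<Phi> \<Longrightarrow> \<forall>k. bounded (range (\<lambda>i::nat. e i k)) \<Longrightarrow> bounded (range (\<lambda>i. \<phi> (e i)))"
    and x: "\<And>\<phi>. \<phi> \<in> \<Phi> \<Longrightarrow> bounded (range (\<lambda>i. \<phi> (x i)))"
  shows "\<exists>e. (\<forall>k. bounded (range (\<lambda>i. e i k))) \<and> (\<forall>i. \<forall>\<phi>\<in>\<Phi>. \<phi> (e i) = \<phi> (x i))"
  using assms
proof (induction \<Phi> rule: finite_induct)
  case empty
  show ?case by (rule exI[of _ "\<lambda>i k. 0"]) auto
next
  case (insert \<phi> \<Phi>)
  obtain e where e: "\<forall>k. bounded (range (\<lambda>i. e i k))" "\<forall>i. \<forall>\<psi>\<in>\<Phi>. \<psi> (e i) = \<psi> (x i)"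
    using insert.IH[OF insert.prems(1) insert.prems(2) insert.prems(3)] by auto
  define z where "z = (\<lambda>i k. x i k + (-1) *\<^sub>R e i k)"
  define g where "g = (\<lambda>i. \<phi> (z i))"
  have z: "\<psi> (z i) = \<psi> (x i) - \<psi> (e i)" if "\<psi> \<in> insert \<phi> \<Phi>" for \<psi> i
    using insert.prems(1)[OF that, of "x i" "-1" "e i"] by (simp add: z_def)
  show ?case
  proof (cases "\<exists>j. g j \<noteq> 0")
    case False
    then have "\<phi> (e i) = \<phi> (x i)" for i using z[of \<phi> i] by (simp add: g_def)
    with e show ?thesis by (intro exI[of _ e]) auto
  next
    case True
    then obtain j where j: "g j \<noteq> 0" by blast
    \<comment> \<open>The same vector \<open>z j\<close> serves every i, so boundedness of
      \<open>g\<close> keeps \<open>e'\<close> bounded. The value of \<open>\<phi>\<close> grows by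
      exactly the missing \<open>g i\<close>, while the old functionals see no change.\<close>
    define e' where "e' = (\<lambda>i k. e i k + (g i / g j) *\<^sub>R z j k)"
    have "bounded (range (\<lambda>i. \<phi> (x i) - \<phi> (e i)))"
      using bounded_minus_comp[of "\<lambda>i. \<phi> (x i)" UNIV "\<lambda>i. \<phi> (e i)"] insert.prems(2)[of \<phi> e] insert.prems(3)[of \<phi>] e(1)
      by simp
    then have "bounded (range g)" using z by (simp add: g_def)
    then obtain B where B: "\<And>i. norm (g i) \<le> B" by (auto simp: bounded_iff)
    have "bounded (range (\<lambda>i. e' i k))" for k
    proof -
      have "bounded (range (\<lambda>i. (g i / g j) *\<^sub>R z j k))"
      proof (rule boundedI)
        fix y assume "y \<in> range (\<lambda>i. (g i / g j) *\<^sub>R z j k)"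
        then obtain i where "y = (g i / g j) *\<^sub>R z j k" by blast
        then have "norm y = norm (g i) / norm (g j) * norm (z j k)" by simp
        also have "\<dots> \<le> B / norm (g j) * norm (z j k)"
          using B[of i] by (intro mult_right_mono divide_right_mono) auto
        finally show "norm y \<le> B / norm (g j) * norm (z j k)" .
      qed
      then show ?thesis unfolding e'_def using e(1) by (intro bounded_plus_comp) auto
    qed
    moreover have "\<psi> (e' i) = \<psi> (x i)" if "\<psi> \<in> insert \<phi> \<Phi>" for i \<psi>
    proof -
      have *: "\<psi> (e' i) = \<psi> (e i) + (g i / g j) * \<psi> (z j)"
        using insert.prems(1)[OF that] by (simp add: e'_def)
      show ?thesis
      proof (cases "\<psi> = \<phi>")
        case True
        then show ?thesis using * j z[of \<phi> i] by (simp add: g_def)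
      next
        case False
        then have "\<psi> (e k) = \<psi> (x k)" for k using that e(2) by blast
        then show ?thesis using * z[OF that, of j] by simp
      qed
    qed
    ultimately show ?thesis by blast
  qed
qed

lemma finite_bounded_convergent_subseq:
  fixes f :: "nat \<Rightarrow> 'a \<Rightarrow> real"
  assumes "finite K" "\<And>k. k \<in> K \<Longrightarrow> bounded (range (\<lambda>i. f i k))"
  shows "\<exists>r l. strict_mono r \<and> (\<forall>k\<in>K. (\<lambda>i. f (r i) k) \<longlonglongrightarrow> l k)"
  using assms
proof (induction K rule: finite_induct)
  case empty
  show ?case by (rule exI[of _ id]) (auto simp: strict_mono_def)
next
  case (insert k K)
  then obtain r l where r: "strict_mono r" "\<forall>k\<in>K. (\<lambda>i. f (r i) k) \<longlonglongrightarrow> l k" by auto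
  have "bounded (range (\<lambda>i. f i k))" using insert by simp
  then have "bounded (range (\<lambda>i. f (r i) k))" by (rule bounded_subset) auto
  then obtain m s where s: "strict_mono s" "((\<lambda>i. f (r i) k) \<circ> s) \<longlonglongrightarrow> m"
    using bounded_imp_convergent_subsequence by blast
  have "strict_mono (r \<circ> s)" using r s by (simp add: strict_mono_o)
  moreover have "(\<lambda>i. f ((r \<circ> s) i) j) \<longlonglongrightarrow> (l(k := m)) j" if "j \<in> insert k K" for j
  proof (cases "j = k")
    case True then show ?thesis using s(2) by (simp add: o_def)
  next
    case False
    then show ?thesis using LIMSEQ_subseq_LIMSEQ[OF _ s(1), of "\<lambda>i. f (r i) j" "l j"] r(2) that
      by (auto simp: o_def)
  qed
  ultimately show ?case by blast
qed

lemma finite_range_constant_subseq: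
  fixes f :: "nat \<Rightarrow> 'a"
  assumes "finite (range f)"
  shows "\<exists>s c. strict_mono (s :: nat \<Rightarrow> nat) \<and> (\<forall>i. f (s i) = c)"
proof -
  obtain j where "infinite {i. f i = f j}"
    using pigeonhole_infinite[of "UNIV :: nat set" f] assms by auto
  then obtain s :: "nat \<Rightarrow> nat" where "strict_mono s" "\<forall>n. s n \<in> {i. f i = f j}"
    using infinite_enumerate by blast
  then show ?thesis by auto
qed

lemma filterlim_at_bot_add_bounded:
  fixes b e :: "nat \<Rightarrow> real"
  assumes "filterlim b at_bot sequentially" "bounded (range e)"
  shows "filterlim (\<lambda>i. b i + e i) at_bot sequentially"
proof -
  obtain B where B: "\<And>i. norm (e i) \<le> B" using assms(2) by (auto simp: bounded_iff)
  have "\<forall>\<^sub>F i in sequentially. b i + e i \<le> Z" for Z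
  proof -
    have "\<forall>\<^sub>F i in sequentially. b i \<le> Z - B"
      using assms(1) by (simp add: filterlim_at_bot)
    then show ?thesis
      by eventually_elim (use B in \<open>smt (verit) real_norm_def\<close>)
  qed
  then show ?thesis by (simp add: filterlim_at_bot)
qed

text \<open>The square root of the slowest rate of divergence is still divergent, but negligible.\<close>

lemma slow_divergence:
  fixes b :: "nat \<Rightarrow> 'a \<Rightarrow> real"
  assumes "finite K" "\<And>a. a \<in> K \<Longrightarrow> filterlim (\<lambda>i. b i a) at_bot sequentially"
  shows "\<exists>t. filterlim t at_top sequentially \<and>
     (\<forall>a\<in>K. \<forall>C. filterlim (\<lambda>i. b i a + t i * C) at_bot sequentially)"
proof -
  \<comment> \<open>\<open>- ln (q i)\<close> is a lower bound for every rate
    \<open>- b i a\<close>. The summand \<open>1 / (real i + 1)\<close> keeps \<open>q\<close>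
    positive even when \<open>K\<close> is empty, and still lets it tend to 0.\<close>
  define q where "q = (\<lambda>i. 1 / (real i + 1) + (\<Sum>a\<in>K. exp (b i a)))"
  define u where "u = (\<lambda>i. - ln (q i))"
  have q_pos: "q i > 0" for i unfolding q_def by (intro add_pos_nonneg sum_nonneg) auto
  have "(\<lambda>i. 1 / (real i + 1)) \<longlonglongrightarrow> 0" by real_asymp
  moreover have "(\<lambda>i. \<Sum>a\<in>K. exp (b i a)) \<longlonglongrightarrow> (\<Sum>a\<in>K. 0)"
    by (intro tendsto_sum filterlim_compose[OF exp_at_bot] assms(2))
  ultimately have "q \<longlonglongrightarrow> 0" unfolding q_def using tendsto_add by fastforce
  then have "filterlim q (at_right 0) sequentially"
    using q_pos by (intro tendsto_imp_filterlim_at_right) auto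
  then have "filterlim (\<lambda>i. ln (q i)) at_bot sequentially"
    by (rule filterlim_compose[OF ln_at_0])
  then have u: "filterlim u at_top sequentially"
    unfolding u_def by (simp add: filterlim_uminus_at_bot)
  have bu: "b i a \<le> - u i" if "a \<in> K" for i a
  proof -
    have "exp (b i a) \<le> (\<Sum>a\<in>K. exp (b i a))"
      using assms(1) that by (intro member_le_sum) auto
    also have "\<dots> \<le> q i" by (simp add: q_def)
    finally have "ln (exp (b i a)) \<le> ln (q i)" using q_pos by (subst ln_le_cancel_iff) auto
    then show ?thesis by (simp add: u_def)
  qed
  have "filterlim (\<lambda>x::real. sqrt x) at_top at_top" by real_asymp
  then have "filterlim (\<lambda>i. sqrt (u i)) at_top sequentially"
    using u by (rule filterlim_compose)
  moreover have "filterlim (\<lambda>i. b i a + sqrt (u i) * C) at_bot sequentially" if "a \<in> K" for a C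
  proof (rule filterlim_at_bot_mono)
    have "filterlim (\<lambda>x::real. - x + sqrt x * C) at_bot at_top" by real_asymp
    then show "filterlim (\<lambda>i. - u i + sqrt (u i) * C) at_bot sequentially"
      using u by (rule filterlim_compose)
  qed (use bu[OF that] in auto)
  ultimately show ?thesis by blast
qed

section \<open>Regular subdivisions and asymptotic faces\<close>

text \<open>Regular subdivisions without the convex hull: an outward normal with positive last
  coordinate is scaled to \<open>(y, 1)\<close>, and the upper face it exposes is recorded by the
  points of \<open>A\<close> whose lifts attain the maximum.\<close>

definition argmax_faces :: "(real^'d) set \<Rightarrow> ((real^'d) \<Rightarrow> real) \<Rightarrow> (real^'d) set set" where
  "argmax_faces A lam = {{a \<in> A. \<forall>b\<in>A. lam b + b \<bullet> y \<le> lam a + a \<bullet> y} | y. True}"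

lemma inner_le_on_convex_hull:
  fixes n :: "'a::real_inner"
  assumes "\<And>q. q \<in> Q \<Longrightarrow> n \<bullet> q \<le> m" "p \<in> convex hull Q"
  shows "n \<bullet> p \<le> m"
proof -
  have "convex hull Q \<subseteq> {p. n \<bullet> p \<le> m}"
    using assms(1) by (intro hull_minimal) (auto simp: convex_halfspace_le)
  then show ?thesis using assms(2) by auto
qed

lemma argmax_inner_face_of:
  fixes n :: "'a::real_inner"
  assumes "convex P"
  shows "{p \<in> P. \<forall>q\<in>P. n \<bullet> q \<le> n \<bullet> p} face_of P"
proof (cases "{p \<in> P. \<forall>q\<in>P. n \<bullet> q \<le> n \<bullet> p} = {}")
  case False
  then obtain p0 where p0: "p0 \<in> P" "\<forall>q\<in>P. n \<bullet> q \<le> n \<bullet> p0" by blast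
  then have "{p \<in> P. \<forall>q\<in>P. n \<bullet> q \<le> n \<bullet> p} = P \<inter> {p. n \<bullet> p = n \<bullet> p0}"
    by (force intro: antisym)
  with p0 assms show ?thesis by (auto intro: face_of_Int_supporting_hyperplane_le)
next
  case True
  show ?thesis by (subst True) simp
qed

text \<open>A linear functional has the same upper bounds on a hull as on its generators, so a
  normal \<open>(c, t)\<close> need only be tested on lifted points of \<open>A\<close>; dividing by
  \<open>t > 0\<close> gives the slope \<open>y = c /\<^sub>R t\<close>.\<close>

lemma reg_subdiv_eq_argmax_faces: "reg_subdiv A lam = argmax_faces A lam"
proof -
  define F where "F c t = {p \<in> liftP A lam. \<forall>q \<in> liftP A lam. (c, t) \<bullet> q \<le> (c, t) \<bullet> p}"
    for c :: "real^'a" and t :: real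
  have mem: "(a, lam a) \<in> liftP A lam" if "a \<in> A" for a
    unfolding liftP_def using that by (intro hull_inc) auto
  have trace: "{a \<in> A. (a, lam a) \<in> F c t} = {a \<in> A. \<forall>b\<in>A. lam b + b \<bullet> (c /\<^sub>R t) \<le> lam a + a \<bullet> (c /\<^sub>R t)}"
    if t: "t > 0" for c t
  proof -
    have "(\<forall>q \<in> liftP A lam. (c, t) \<bullet> q \<le> (c, t) \<bullet> (a, lam a)) \<longleftrightarrow>
      (\<forall>b\<in>A. (c, t) \<bullet> (b, lam b) \<le> (c, t) \<bullet> (a, lam a))" for a
    proof
      assume *: "\<forall>b\<in>A. (c, t) \<bullet> (b, lam b) \<le> (c, t) \<bullet> (a, lam a)"
      show "\<forall>q \<in> liftP A lam. (c, t) \<bullet> q \<le> (c, t) \<bullet> (a, lam a)"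
        unfolding liftP_def
        using inner_le_on_convex_hull[of "(\<lambda>a. (a, lam a)) ` A" "(c, t)"] * by blast
    qed (use mem in blast)
    moreover have "(c, t) \<bullet> (b, lam b) \<le> (c, t) \<bullet> (a, lam a) \<longleftrightarrow>
        lam b + b \<bullet> (c /\<^sub>R t) \<le> lam a + a \<bullet> (c /\<^sub>R t)" for a b
    proof -
      have "(c, t) \<bullet> (b, lam b) = t * (lam b + b \<bullet> (c /\<^sub>R t))" for b
        using t by (simp add: inner_commute algebra_simps)
      then show ?thesis using t by simp
    qed
    ultimately show ?thesis using mem by (auto simp: F_def)
  qed
  have face: "upper_face A lam (F c t)" if "t > 0" for c t
    unfolding upper_face_def F_def using that
    by (intro conjI argmax_inner_face_of exI[of _ c] exI[of _ t]) (auto simp: liftP_def)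
  show ?thesis
  proof
    show "reg_subdiv A lam \<subseteq> argmax_faces A lam"
    proof
      fix G assume "G \<in> reg_subdiv A lam"
      then obtain c t where ct: "t > 0" "G = {a \<in> A. (a, lam a) \<in> F c t}"
        unfolding reg_subdiv_def upper_face_def F_def by blast
      then show "G \<in> argmax_faces A lam"
        unfolding argmax_faces_def using trace[OF ct(1), of c] by blast
    qed
    show "argmax_faces A lam \<subseteq> reg_subdiv A lam"
    proof
      fix G assume "G \<in> argmax_faces A lam"
      then obtain y where y: "G = {a \<in> A. \<forall>b\<in>A. lam b + b \<bullet> y \<le> lam a + a \<bullet> y}"
        unfolding argmax_faces_def by blast
      have "G = {a \<in> A. (a, lam a) \<in> F y 1}" using trace[of 1 y] y by simp
      then show "G \<in> reg_subdiv A lam" unfolding reg_subdiv_def using face[of 1 y] by auto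
    qed
  qed
qed

text \<open>Naming the maximal value \<open>c\<close> separates a face into equalities on
  \<open>G\<close> and strict inequalities off \<open>G\<close>, the form that
  \<open>asymp_face\<close> relaxes.\<close>

lemma argmax_faces_iff:
  assumes "finite A" "A \<noteq> {}"
  shows "G \<in> argmax_faces A lam \<longleftrightarrow> G \<noteq> {} \<and> G \<subseteq> A \<and>
    (\<exists>y c. (\<forall>a\<in>G. lam a + a \<bullet> y = c) \<and> (\<forall>a\<in>A - G. lam a + a \<bullet> y < c))"
proof
  assume "G \<in> argmax_faces A lam"
  then obtain y where y: "G = {a \<in> A. \<forall>b\<in>A. lam b + b \<bullet> y \<le> lam a + a \<bullet> y}"
    by (auto simp: argmax_faces_def)
  define c where "c = Max ((\<lambda>a. lam a + a \<bullet> y) ` A)"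
  have le: "lam a + a \<bullet> y \<le> c" if "a \<in> A" for a using assms that by (simp add: c_def)
  have "c \<in> (\<lambda>a. lam a + a \<bullet> y) ` A" unfolding c_def using assms by (intro Max_in) auto
  then obtain a0 where a0: "a0 \<in> A" "lam a0 + a0 \<bullet> y = c" by auto
  have G: "G = {a \<in> A. lam a + a \<bullet> y = c}"
  proof (intro set_eqI iffI)
    fix a assume "a \<in> G"
    then have "a \<in> A" "lam a0 + a0 \<bullet> y \<le> lam a + a \<bullet> y" using a0(1) by (auto simp: y)
    then show "a \<in> {a \<in> A. lam a + a \<bullet> y = c}" using le[of a] a0(2) by simp
  qed (use le y in simp)
  show "G \<noteq> {} \<and> G \<subseteq> A \<and>
    (\<exists>y c. (\<forall>a\<in>G. lam a + a \<bullet> y = c) \<and> (\<forall>a\<in>A - G. lam a + a \<bullet> y < c))"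
  proof (intro conjI exI[of _ y] exI[of _ c] ballI)
    fix a assume "a \<in> A - G"
    then show "lam a + a \<bullet> y < c" using le[of a] by (auto simp: G)
  qed (use a0 in \<open>auto simp: G\<close>)
next
  assume "G \<noteq> {} \<and> G \<subseteq> A \<and>
    (\<exists>y c. (\<forall>a\<in>G. lam a + a \<bullet> y = c) \<and> (\<forall>a\<in>A - G. lam a + a \<bullet> y < c))"
  then obtain y c where G: "G \<noteq> {}" "G \<subseteq> A" "\<And>a. a \<in> G \<Longrightarrow> lam a + a \<bullet> y = c"
    "\<And>a. a \<in> A - G \<Longrightarrow> lam a + a \<bullet> y < c" by blast
  obtain a0 where a0: "a0 \<in> G" using G(1) by blast
  have le: "lam b + b \<bullet> y \<le> c" if "b \<in> A" for b
    using G(3)[of b] G(4)[of b] that by (cases "b \<in> G") auto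
  have "G = {a \<in> A. \<forall>b\<in>A. lam b + b \<bullet> y \<le> lam a + a \<bullet> y}"
  proof (intro set_eqI iffI)
    fix a assume "a \<in> G"
    then show "a \<in> {a \<in> A. \<forall>b\<in>A. lam b + b \<bullet> y \<le> lam a + a \<bullet> y}"
      using G(2) G(3) le by auto
  next
    fix a assume a: "a \<in> {a \<in> A. \<forall>b\<in>A. lam b + b \<bullet> y \<le> lam a + a \<bullet> y}"
    then have "lam a0 + a0 \<bullet> y \<le> lam a + a \<bullet> y" using a0 G(2) by auto
    then show "a \<in> G" using G(4)[of a] G(3)[OF a0] a by force
  qed
  then show "G \<in> argmax_faces A lam" by (auto simp: argmax_faces_def)
qed

section \<open>Asymptotic faces of a sequence of weights\<close>

text \<open>The criterion of \<open>argmax_faces_iff\<close> up to bounded error: equality becomes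
  boundedness and strict inequality becomes divergence. Both \<open>y\<close> and the normalisation
  \<open>c\<close> may vary with the index.\<close>

definition asymp_face :: "(real^'d) set \<Rightarrow> (nat \<Rightarrow> (real^'d) \<Rightarrow> real) \<Rightarrow> (real^'d) set \<Rightarrow> bool" where
  "asymp_face A v G \<longleftrightarrow> G \<noteq> {} \<and> G \<subseteq> A \<and> (\<exists>y c.
     (\<forall>a\<in>G. bounded (range (\<lambda>i. v i a + a \<bullet> y i - c i))) \<and>
     (\<forall>a\<in>A - G. filterlim (\<lambda>i. v i a + a \<bullet> y i - c i) at_bot sequentially))"

lemma asymp_face_subseq:
  assumes "asymp_face A v G" "strict_mono s"
  shows "asymp_face A (\<lambda>i. v (s i)) G"
proof -
  obtain y c where yc: "G \<noteq> {}" "G \<subseteq> A"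
    "\<And>a. a \<in> G \<Longrightarrow> bounded (range (\<lambda>i. v i a + a \<bullet> y i - c i))"
    "\<And>a. a \<in> A - G \<Longrightarrow> filterlim (\<lambda>i. v i a + a \<bullet> y i - c i) at_bot sequentially"
    using assms(1) unfolding asymp_face_def by blast
  have "bounded (range (\<lambda>i. v (s i) a + a \<bullet> y (s i) - c (s i)))" if "a \<in> G" for a
    by (rule bounded_subset[OF yc(3)[OF that]]) auto
  moreover have "filterlim (\<lambda>i. v (s i) a + a \<bullet> y (s i) - c (s i)) at_bot sequentially"
    if "a \<in> A - G" for a
    by (rule filterlim_compose[OF yc(4)[OF that] filterlim_subseq[OF assms(2)]])
  ultimately show ?thesis unfolding asymp_face_def using yc(1,2)
    by (intro conjI exI[of _ "\<lambda>i. y (s i)"] exI[of _ "\<lambda>i. c (s i)"]) auto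
qed

text \<open>The same \<open>y\<close> and \<open>c\<close> work for both sequences. This transfers
  faces from the corrected weights back to the original ones.\<close>

lemma asymp_face_add_bounded:
  assumes "asymp_face A v G" "\<And>a. a \<in> A \<Longrightarrow> bounded (range (\<lambda>i. u i a - v i a))"
  shows "asymp_face A u G"
proof -
  obtain y c where yc: "G \<noteq> {}" "G \<subseteq> A"
    "\<And>a. a \<in> G \<Longrightarrow> bounded (range (\<lambda>i. v i a + a \<bullet> y i - c i))"
    "\<And>a. a \<in> A - G \<Longrightarrow> filterlim (\<lambda>i. v i a + a \<bullet> y i - c i) at_bot sequentially"
    using assms(1) unfolding asymp_face_def by blast
  have eq: "(\<lambda>i. u i a + a \<bullet> y i - c i) = (\<lambda>i. (v i a + a \<bullet> y i - c i) + (u i a - v i a))" for a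
    by auto
  have "bounded (range (\<lambda>i. u i a + a \<bullet> y i - c i))" if "a \<in> G" for a
    unfolding eq using yc(2,3) assms(2) that by (intro bounded_plus_comp) auto
  moreover have "filterlim (\<lambda>i. u i a + a \<bullet> y i - c i) at_bot sequentially" if "a \<in> A - G" for a
    unfolding eq using yc(4) assms(2) that by (intro filterlim_at_bot_add_bounded) auto
  ultimately show ?thesis unfolding asymp_face_def using yc(1,2)
    by (intro conjI exI[of _ y] exI[of _ c]) auto
qed

text \<open>The set \<open>N r\<close> of asymptotic faces lies in the finite set
  \<open>Pow A\<close> and, by \<open>asymp_face_subseq\<close>, can only grow under further
  thinning. A subsequence that maximises its cardinality leaves no room for growth.\<close>

lemma asymp_faces_stable_subseq:
  fixes v :: "nat \<Rightarrow> (real^'d) \<Rightarrow> real"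
  assumes "finite A"
  shows "\<exists>r. strict_mono r \<and> (\<forall>s G. strict_mono s \<longrightarrow>
    asymp_face A (\<lambda>i. v (r (s i))) G \<longrightarrow> asymp_face A (\<lambda>i. v (r i)) G)"
proof -
  define N where "N r = {G. asymp_face A (\<lambda>i. v (r i)) G}" for r :: "nat \<Rightarrow> nat"
  have sub: "N r \<subseteq> Pow A" for r by (auto simp: N_def asymp_face_def)
  have fin: "finite (N r)" for r using sub assms by (meson finite_Pow_iff finite_subset)
  have "\<forall>r. strict_mono r \<longrightarrow> card (N r) < Suc (card (Pow A))"
    using sub assms by (simp add: card_mono less_Suc_eq_le del: card_Pow)
  moreover have "strict_mono (id :: nat \<Rightarrow> nat)" by (simp add: strict_mono_def)
  ultimately obtain r where r: "strict_mono r" "\<And>r'. strict_mono r' \<Longrightarrow> card (N r') \<le> card (N r)"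
    using ex_has_greatest_nat[of strict_mono id "\<lambda>r. card (N r)" "Suc (card (Pow A))"] 
    by (metis less_imp_le)
  have "asymp_face A (\<lambda>i. v (r i)) G"
    if "strict_mono s" "asymp_face A (\<lambda>i. v (r (s i))) G" for s G
  proof -
    have "N r \<subseteq> N (r \<circ> s)"
      unfolding N_def using asymp_face_subseq[OF _ that(1)] by auto
    moreover have "card (N (r \<circ> s)) \<le> card (N r)"
      using r that(1) by (simp add: strict_mono_o)
    ultimately have "N r = N (r \<circ> s)" using fin by (simp add: card_seteq)
    moreover have "G \<in> N (r \<circ> s)" using that(2) by (simp add: N_def)
    ultimately show ?thesis by (auto simp: N_def)
  qed
  with r(1) show ?thesis by blast
qed

text \<open>Compactness for exponents normalised to have maximum 0: their exponentials lie in the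
  interval (0, 1], so a subsequence converges. \<open>G\<close> is where the limit is positive; a
  zero limit forces the exponent to minus infinity.\<close>

lemma convergent_or_at_bot_subseq:
  fixes f :: "nat \<Rightarrow> 'a \<Rightarrow> real"
  assumes "finite A" "\<And>i a. a \<in> A \<Longrightarrow> f i a \<le> 0" "\<And>i. \<exists>a\<in>A. f i a = 0"
  shows "\<exists>s G l. strict_mono s \<and> G \<noteq> {} \<and> G \<subseteq> A \<and> (\<forall>a\<in>G. (\<lambda>i. f (s i) a) \<longlonglongrightarrow> l a) \<and>
    (\<forall>a\<in>A - G. filterlim (\<lambda>i. f (s i) a) at_bot sequentially)"
proof -
  have "bounded (range (\<lambda>i. exp (f i a)))" if "a \<in> A" for a
    by (rule boundedI[of _ 1]) (use assms(2)[OF that] in auto)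
  then obtain s m where s: "strict_mono s" "\<And>a. a \<in> A \<Longrightarrow> (\<lambda>i. exp (f (s i) a)) \<longlonglongrightarrow> m a"
    using finite_bounded_convergent_subseq[OF assms(1), of "\<lambda>i a. exp (f i a)"] by blast
  define G where "G = {a \<in> A. m a \<noteq> 0}"
  have "(\<lambda>i. f (s i) a) \<longlonglongrightarrow> ln (m a)" if "a \<in> G" for a
  proof -
    have "(\<lambda>i. ln (exp (f (s i) a))) \<longlonglongrightarrow> ln (m a)"
      using that s(2) by (intro tendsto_ln) (auto simp: G_def)
    then show ?thesis by simp
  qed
  moreover have "filterlim (\<lambda>i. f (s i) a) at_bot sequentially" if "a \<in> A - G" for a
  proof -
    have "(\<lambda>i. exp (f (s i) a)) \<longlonglongrightarrow> 0" using that s(2)[of a] by (auto simp: G_def)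
    then have "filterlim (\<lambda>i. exp (f (s i) a)) (at_right 0) sequentially"
      by (intro tendsto_imp_filterlim_at_right) auto
    then have "filterlim (\<lambda>i. ln (exp (f (s i) a))) at_bot sequentially"
      by (rule filterlim_compose[OF ln_at_0])
    then show ?thesis by simp
  qed
  \<comment> \<open>At every index some exponent is 0, so the exponentials sum to at least 1 and
    cannot all tend to 0.\<close>
  moreover have "G \<noteq> {}"
  proof
    assume "G = {}"
    then have "(\<lambda>i. \<Sum>a\<in>A. exp (f (s i) a)) \<longlonglongrightarrow> (\<Sum>a\<in>A. 0)"
      using s(2) by (intro tendsto_sum) (auto simp: G_def)
    moreover have "1 \<le> (\<Sum>a\<in>A. exp (f (s i) a))" for i
    proof -
      obtain a where "a \<in> A" "f (s i) a = 0" using assms(3) by blast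
      then show ?thesis
        using member_le_sum[of a A "\<lambda>a. exp (f (s i) a)"] assms(1) by simp
    qed
    ultimately have "(1::real) \<le> (\<Sum>a\<in>A. 0)" by (intro LIMSEQ_le_const) auto
    then show False by simp
  qed
  ultimately show ?thesis using s(1) by (intro exI[of _ s] exI[of _ G] exI[of _ "\<lambda>a. ln (m a)"]) (auto simp: G_def)
qed

text \<open>The bounded expressions \<open>v i a + a \<bullet> y i - c i\<close> are linear in the
  weights together with the \<open>y\<close> and \<open>c\<close> of every face.
  \<open>bounded_linear_lift\<close> yields one bounded vector with the same values; subtracting it
  makes them vanish for all faces simultaneously, with a single correction \<open>e\<close> of the
  weights.\<close>

lemma asymp_faces_exact_lift:
  fixes v :: "nat \<Rightarrow> (real^'d) \<Rightarrow> real"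
  assumes "finite A"
  shows "\<exists>e. (\<forall>a. bounded (range (\<lambda>i. e i a))) \<and> (\<forall>G. asymp_face A v G \<longrightarrow> (\<exists>y c.
     (\<forall>i. \<forall>a\<in>G. v i a - e i a + a \<bullet> y i = c i) \<and>
     (\<forall>a\<in>A - G. filterlim (\<lambda>i. v i a - e i a + a \<bullet> y i - c i) at_bot sequentially)))"
proof -
  obtain y c where yc:
    "\<And>G a. asymp_face A v G \<Longrightarrow> a \<in> G \<Longrightarrow> bounded (range (\<lambda>i. v i a + a \<bullet> y G i - c G i))"
    "\<And>G a. asymp_face A v G \<Longrightarrow> a \<in> A - G \<Longrightarrow> filterlim (\<lambda>i. v i a + a \<bullet> y G i - c G i) at_bot sequentially"
  proof -
    have "\<forall>G. \<exists>yc. asymp_face A v G \<longrightarrow>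
      (\<forall>a\<in>G. bounded (range (\<lambda>i. v i a + a \<bullet> fst yc i - snd yc i))) \<and>
      (\<forall>a\<in>A - G. filterlim (\<lambda>i. v i a + a \<bullet> fst yc i - snd yc i) at_bot sequentially)"
      by (simp add: asymp_face_def)
    from choice[OF this] obtain yc where "\<forall>G. asymp_face A v G \<longrightarrow>
      (\<forall>a\<in>G. bounded (range (\<lambda>i. v i a + a \<bullet> fst (yc G) i - snd (yc G) i))) \<and>
      (\<forall>a\<in>A - G. filterlim (\<lambda>i. v i a + a \<bullet> fst (yc G) i - snd (yc G) i) at_bot sequentially)"
      by blast
    then show ?thesis using that[of "\<lambda>G. fst (yc G)" "\<lambda>G. snd (yc G)"] by blast
  qed
  \<comment> \<open>Values of v and the data (y, c) of all faces form one vector, corrected simultaneously.\<close>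
  define x :: "nat \<Rightarrow> (real^'d) + (real^'d) set \<Rightarrow> (real^'d) \<times> real"
    where "x i k = (case k of Inl a \<Rightarrow> (0, v i a) | Inr G \<Rightarrow> (y G i, c G i))" for i k
  \<comment> \<open>The expression attached to a face \<open>G\<close> and a point \<open>a\<close>,
    read as a functional of the combined vector; an \<open>Inl\<close> entry contributes only its
    real component.\<close>
  define \<phi> :: "(real^'d) set \<times> (real^'d) \<Rightarrow> ((real^'d) + (real^'d) set \<Rightarrow> (real^'d) \<times> real) \<Rightarrow> real"
    where "\<phi> = (\<lambda>(G, a) u. snd (u (Inl a)) + a \<bullet> fst (u (Inr G)) - snd (u (Inr G)))"
  define \<Phi> where "\<Phi> = \<phi> ` {(G, a). asymp_face A v G \<and> a \<in> G}"
  have bnd: "bounded (range (\<lambda>i. \<phi> (G, a) (e i)))"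
    if "\<forall>k. bounded (range (\<lambda>i::nat. e i k))" for G a and e :: "nat \<Rightarrow> _ \<Rightarrow> _"
  proof -
    have 1: "bounded (range (\<lambda>i. fst (e i k)))" "bounded (range (\<lambda>i. snd (e i k)))" for k
      using bounded_fst[of "range (\<lambda>i. e i k)"] bounded_snd[of "range (\<lambda>i. e i k)"] that
      by (auto simp: image_image)
    have "bounded (range (\<lambda>i. a \<bullet> fst (e i k)))" for k
      using bounded_linear_image[OF 1(1)[of k] bounded_linear_inner_right[of a]]
      by (simp add: image_image)
    with 1 show ?thesis unfolding \<phi>_def by (auto intro!: bounded_plus_comp bounded_minus_comp)
  qed
  have "\<exists>e. (\<forall>k. bounded (range (\<lambda>i. e i k))) \<and> (\<forall>i. \<forall>\<psi>\<in>\<Phi>. \<psi> (e i) = \<psi> (x i))"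
  proof (rule bounded_linear_lift)
    have "{(G, a). asymp_face A v G \<and> a \<in> G} \<subseteq> Pow A \<times> A" by (auto simp: asymp_face_def)
    then show "finite \<Phi>" unfolding \<Phi>_def using assms by (meson finite_Pow_iff finite_SigmaI finite_imageI finite_subset)
    show "\<psi> (\<lambda>k. u k + s *\<^sub>R z k) = \<psi> u + s * \<psi> z" if "\<psi> \<in> \<Phi>" for \<psi> u s z
      using that by (auto simp: \<Phi>_def \<phi>_def inner_add_right algebra_simps)
    show "bounded (range (\<lambda>i. \<psi> (e i)))"
      if "\<psi> \<in> \<Phi>" "\<forall>k. bounded (range (\<lambda>i::nat. e i k))" for \<psi> e
      using that bnd[OF that(2)] by (auto simp: \<Phi>_def)
    show "bounded (range (\<lambda>i. \<psi> (x i)))" if "\<psi> \<in> \<Phi>" for \<psi>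
      using that yc(1) by (auto simp: \<Phi>_def \<phi>_def x_def)
  qed
  then obtain e where e: "\<forall>k. bounded (range (\<lambda>i. e i k))" "\<And>i \<psi>. \<psi> \<in> \<Phi> \<Longrightarrow> \<psi> (e i) = \<psi> (x i)"
    by blast
  show ?thesis
  proof (intro exI[of _ "\<lambda>i a. snd (e i (Inl a))"] conjI allI impI)
    fix a show "bounded (range (\<lambda>i. snd (e i (Inl a))))"
      using bounded_snd[of "range (\<lambda>i. e i (Inl a))"] e(1) by (simp add: image_image)
  next
    fix G assume G: "asymp_face A v G"
    define y' where "y' i = y G i - fst (e i (Inr G))" for i
    define c' where "c' i = c G i - snd (e i (Inr G))" for i
    \<comment> \<open>On \<open>G\<close> the last term cancels the bracket exactly, by the choice
      of \<open>e\<close>; off \<open>G\<close> it is a bounded perturbation of a divergent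
      sequence.\<close>
    have eq: "v i a - snd (e i (Inl a)) + a \<bullet> y' i - c' i
      = (v i a + a \<bullet> y G i - c G i) - \<phi> (G, a) (e i)" for i a
      by (simp add: \<phi>_def y'_def c'_def inner_diff_right)
    show "\<exists>y c. (\<forall>i. \<forall>a\<in>G. v i a - snd (e i (Inl a)) + a \<bullet> y i = c i) \<and>
     (\<forall>a\<in>A - G. filterlim (\<lambda>i. v i a - snd (e i (Inl a)) + a \<bullet> y i - c i) at_bot sequentially)"
    proof (intro exI[of _ y'] exI[of _ c'] conjI allI ballI)
      fix i a assume a: "a \<in> G"
      have "\<phi> (G, a) (e i) = \<phi> (G, a) (x i)" using G a by (intro e(2)) (auto simp: \<Phi>_def)
      also have "\<dots> = v i a + a \<bullet> y G i - c G i" by (simp add: \<phi>_def x_def)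
      finally show "v i a - snd (e i (Inl a)) + a \<bullet> y' i = c' i" using eq[of i a] by simp
    next
      fix a assume a: "a \<in> A - G"
      have "bounded (range (\<lambda>i. - \<phi> (G, a) (e i)))" using bnd[OF e(1), of G a] by (auto simp: bounded_iff)
      from filterlim_at_bot_add_bounded[OF yc(2)[OF G a] this]
      show "filterlim (\<lambda>i. v i a - snd (e i (Inl a)) + a \<bullet> y' i - c' i) at_bot sequentially"
        unfolding eq by simp
    qed
  qed
qed

section \<open>A single subdivision carrying all asymptotic faces\<close>

text \<open>All \<open>lam i\<close> induce the same subdivision, represented by
  \<open>lam0\<close>. Its faces can be exposed with equality on the face and divergence off it, and
  no subsequence has an asymptotic face outside it. These two facts feed the two halves of the
  Hausdorff estimate.\<close>

lemma stable_exact_subdivision: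
  fixes v :: "nat \<Rightarrow> (real^'d) \<Rightarrow> real"
  assumes A: "finite A" "A \<noteq> {}"
  shows "\<exists>r lam0 lam \<epsilon>. strict_mono r \<and> (\<forall>a\<in>A. (\<lambda>i. v (r i) a - lam i a) \<longlonglongrightarrow> \<epsilon> a) \<and>
    (\<forall>G\<in>argmax_faces A lam0. \<exists>y c. (\<forall>i. \<forall>a\<in>G. lam i a + a \<bullet> y i = c i) \<and>
       (\<forall>a\<in>A - G. filterlim (\<lambda>i. lam i a + a \<bullet> y i - c i) at_bot sequentially)) \<and>
    (\<forall>s G. strict_mono s \<longrightarrow> asymp_face A (\<lambda>i. v (r (s i))) G \<longrightarrow> G \<in> argmax_faces A lam0)"
proof -
  obtain r where r: "strict_mono r"
    "\<And>s G. strict_mono s \<Longrightarrow> asymp_face A (\<lambda>i. v (r (s i))) G \<Longrightarrow> asymp_face A (\<lambda>i. v (r i)) G"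
    using asymp_faces_stable_subseq[OF A(1)] by blast
  obtain e where e: "\<And>a. bounded (range (\<lambda>i. e i a))"
    "\<And>G. asymp_face A (\<lambda>i. v (r i)) G \<Longrightarrow> \<exists>y c.
     (\<forall>i. \<forall>a\<in>G. v (r i) a - e i a + a \<bullet> y i = c i) \<and>
     (\<forall>a\<in>A - G. filterlim (\<lambda>i. v (r i) a - e i a + a \<bullet> y i - c i) at_bot sequentially)"
    using asymp_faces_exact_lift[OF A(1), of "\<lambda>i. v (r i)"] by blast
  obtain s1 \<epsilon> where s1: "strict_mono s1" "\<And>a. a \<in> A \<Longrightarrow> (\<lambda>i. e (s1 i) a) \<longlonglongrightarrow> \<epsilon> a"
    using finite_bounded_convergent_subseq[OF A(1), of e] e(1) by blast
  define lam1 where "lam1 i a = v (r i) a - e i a" for i a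
  \<comment> \<open>There are only finitely many sets of subsets of \<open>A\<close>, so one
    subdivision \<open>S\<close> occurs along a whole subsequence.\<close>
  have "argmax_faces A l \<subseteq> Pow A" for l by (auto simp: argmax_faces_def)
  then have "range (\<lambda>i. argmax_faces A (lam1 (s1 i))) \<subseteq> Pow (Pow A)" by blast
  then have "finite (range (\<lambda>i. argmax_faces A (lam1 (s1 i))))"
    using A(1) by (simp add: finite_subset)
  then obtain s2 :: "nat \<Rightarrow> nat" and S where s2: "strict_mono s2" "\<And>i. argmax_faces A (lam1 (s1 (s2 i))) = S"
    using finite_range_constant_subseq[of "\<lambda>i. argmax_faces A (lam1 (s1 i))"] by blast
  define t where "t = s1 \<circ> s2"
  have t: "strict_mono t" using s1(1) s2(1) by (simp add: t_def strict_mono_o)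
  define lam where "lam i = lam1 (t i)" for i
  have S: "argmax_faces A (lam i) = S" for i using s2(2) by (simp add: lam_def t_def)
  have iff: "G \<in> S \<longleftrightarrow> G \<noteq> {} \<and> G \<subseteq> A \<and>
    (\<exists>y c. (\<forall>a\<in>G. lam i a + a \<bullet> y = c) \<and> (\<forall>a\<in>A - G. lam i a + a \<bullet> y < c))" for G i
    unfolding S[of i, symmetric] by (rule argmax_faces_iff[OF A])
  have lim: "(\<lambda>i. v (r (t i)) a - lam i a) \<longlonglongrightarrow> \<epsilon> a" if "a \<in> A" for a
    using LIMSEQ_subseq_LIMSEQ[OF s1(2)[OF that] s2(1)]
    by (simp add: lam_def lam1_def t_def o_def)
  \<comment> \<open>By stability of \<open>r\<close>, an asymptotic face of a further subsequence is
    already one of the full sequence, where the exact correction applies. The resulting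
    \<open>y\<close> and \<open>c\<close> are therefore valid at every index.\<close>
  have exact: "\<exists>y c. (\<forall>i. \<forall>a\<in>G. lam i a + a \<bullet> y i = c i) \<and>
       (\<forall>a\<in>A - G. filterlim (\<lambda>i. lam i a + a \<bullet> y i - c i) at_bot sequentially)"
    if "strict_mono s" "asymp_face A (\<lambda>i. v (r (t (s i)))) G" for s G
  proof -
    have "asymp_face A (\<lambda>i. v (r i)) G"
      using r(2)[of "t \<circ> s" G] that t by (simp add: strict_mono_o)
    then obtain y c where yc: "\<And>i a. a \<in> G \<Longrightarrow> lam1 i a + a \<bullet> y i = c i"
      "\<And>a. a \<in> A - G \<Longrightarrow> filterlim (\<lambda>i. lam1 i a + a \<bullet> y i - c i) at_bot sequentially"
      using e(2) unfolding lam1_def by blast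
    have "filterlim (\<lambda>i. lam i a + a \<bullet> y (t i) - c (t i)) at_bot sequentially"
      if "a \<in> A - G" for a
      unfolding lam_def by (rule filterlim_compose[OF yc(2)[OF that] filterlim_subseq[OF t]])
    then show ?thesis
      using yc(1) by (intro exI[of _ "\<lambda>i. y (t i)"] exI[of _ "\<lambda>i. c (t i)"]) (auto simp: lam_def)
  qed
  \<comment> \<open>Divergence makes all finitely many inequalities strict at some index i. Since
    every \<open>lam i\<close> induces \<open>S\<close>, one such index suffices.\<close>
  have asymp_in_S: "G \<in> S" if G: "strict_mono s" "asymp_face A (\<lambda>i. v (r (t (s i)))) G" for s G
  proof -
    obtain y c where yc: "\<And>i a. a \<in> G \<Longrightarrow> lam i a + a \<bullet> y i = c i"
      "\<And>a. a \<in> A - G \<Longrightarrow> filterlim (\<lambda>i. lam i a + a \<bullet> y i - c i) at_bot sequentially"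
      using exact[OF G] by blast
    have "\<forall>\<^sub>F i in sequentially. \<forall>a\<in>A - G. lam i a + a \<bullet> y i - c i < 0"
    proof (rule eventually_ball_finite)
      show "\<forall>a\<in>A - G. \<forall>\<^sub>F i in sequentially. lam i a + a \<bullet> y i - c i < 0"
        using yc(2) by (simp only: filterlim_at_bot_dense) blast
    qed (use A(1) in simp)
    then obtain i where "\<forall>a\<in>A - G. lam i a + a \<bullet> y i - c i < 0"
      using eventually_happens'[OF sequentially_bot] by blast
    then have "\<forall>a\<in>A - G. lam i a + a \<bullet> y i < c i" by simp
    then show ?thesis using G(2) yc(1) unfolding iff[of G i] asymp_face_def by blast
  qed
  have "\<exists>y c. (\<forall>i. \<forall>a\<in>F. lam i a + a \<bullet> y i = c i) \<and>
       (\<forall>a\<in>A - F. filterlim (\<lambda>i. lam i a + a \<bullet> y i - c i) at_bot sequentially)"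
    if F: "F \<in> S" for F
  proof -
    have F': "F \<noteq> {}" "F \<subseteq> A" using F iff by blast+
    have "\<forall>i. \<exists>yc. (\<forall>a\<in>F. lam i a + a \<bullet> fst yc = snd yc) \<and> (\<forall>a\<in>A - F. lam i a + a \<bullet> fst yc < snd yc)"
    proof
      fix i
      show "\<exists>yc. (\<forall>a\<in>F. lam i a + a \<bullet> fst yc = snd yc) \<and> (\<forall>a\<in>A - F. lam i a + a \<bullet> fst yc < snd yc)"
        using F unfolding iff[of F i] by simp
    qed
    from choice[OF this] obtain yc where yc: "\<And>i a. a \<in> F \<Longrightarrow> lam i a + a \<bullet> fst (yc i) = snd (yc i)"
      "\<And>i a. a \<in> A - F \<Longrightarrow> lam i a + a \<bullet> fst (yc i) < snd (yc i)" by blast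
    \<comment> \<open>The depth of each point below the face \<open>F\<close> at index i, as a
      nonpositive number. Off \<open>F\<close> it may fail to diverge, so a subsequence splits
      \<open>A\<close> into a set \<open>G\<close>, on which \<open>f\<close> converges, and the
      rest, where it diverges. \<open>F\<close> lies in \<open>G\<close> because \<open>f\<close> is
      0 there.\<close>
    define f where "f i a = lam i a + a \<bullet> fst (yc i) - snd (yc i)" for i a
    have f_le: "f i a \<le> 0" if "a \<in> A" for i a
      using yc(1)[of a i] yc(2)[of a i] that by (cases "a \<in> F") (auto simp: f_def)
    have f_0: "f i a = 0" if "a \<in> F" for i a using yc(1)[OF that] by (simp add: f_def)
    have "\<exists>a\<in>A. f i a = 0" for i using f_0 F' by blast
    then obtain s G l where s: "strict_mono s" and G: "G \<noteq> {}" "G \<subseteq> A"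
      "\<And>a. a \<in> G \<Longrightarrow> (\<lambda>i. f (s i) a) \<longlonglongrightarrow> l a"
      "\<And>a. a \<in> A - G \<Longrightarrow> filterlim (\<lambda>i. f (s i) a) at_bot sequentially"
      using convergent_or_at_bot_subseq[OF A(1), of f] f_le by metis
    have "F \<subseteq> G"
    proof
      fix a assume a: "a \<in> F"
      show "a \<in> G"
      proof (rule ccontr)
        assume "a \<notin> G"
        then have "filterlim (\<lambda>i. 0::real) at_bot sequentially"
          using G(4)[of a] F'(2) a f_0 by auto
        then have "\<forall>\<^sub>F i::nat in sequentially. (0::real) \<le> -1" by (simp only: filterlim_at_bot)
        then show False by simp
      qed
    qed
    have "asymp_face A (\<lambda>i. lam (s i)) G"
      unfolding asymp_face_def
    proof (intro conjI exI[of _ "\<lambda>i. fst (yc (s i))"] exI[of _ "\<lambda>i. snd (yc (s i))"] ballI)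
      fix a assume "a \<in> G"
      then show "bounded (range (\<lambda>i. lam (s i) a + a \<bullet> fst (yc (s i)) - snd (yc (s i))))"
        using G(3) convergent_imp_bounded unfolding f_def by blast
    qed (use G in \<open>auto simp: f_def\<close>)
    then have "asymp_face A (\<lambda>i. v (r (t (s i)))) G"
    proof (rule asymp_face_add_bounded)
      fix a
      show "bounded (range (\<lambda>i. v (r (t (s i))) a - lam (s i) a))"
        by (rule bounded_subset[OF e(1)[of a]]) (auto simp: lam_def lam1_def)
    qed
    from exact[OF s this] obtain y c where y: "\<And>i a. a \<in> G \<Longrightarrow> lam i a + a \<bullet> y i = c i"
      "\<And>a. a \<in> A - G \<Longrightarrow> filterlim (\<lambda>i. lam i a + a \<bullet> y i - c i) at_bot sequentially"
      by blast
    \<comment> \<open>On \<open>G\<close>, \<open>lam 0\<close> is affine by the choice of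
      \<open>y\<close> and \<open>c\<close>, so there \<open>a \<bullet> h - k\<close> equals
      \<open>f 0 a\<close>: zero on \<open>F\<close>, negative on \<open>G - F\<close>. Index 0 is
      an arbitrary choice; what matters is that this functional does not depend on i.\<close>
    define h where "h = fst (yc 0) - y 0"
    define k where "k = snd (yc 0) - c 0"
    have h_F: "a \<bullet> h = k" if "a \<in> F" for a
      using y(1)[of a 0] yc(1)[of a 0] that \<open>F \<subseteq> G\<close> by (auto simp: h_def k_def inner_diff_right)
    have h_G: "a \<bullet> h - k < 0" if "a \<in> G - F" for a
      using y(1)[of a 0] yc(2)[of a 0] that G(2) by (auto simp: h_def k_def inner_diff_right)
    \<comment> \<open>Adding \<open>\<tau> i\<close> times the functional drives
      \<open>G - F\<close> to minus infinity, slowly enough that the points outside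
      \<open>G\<close>, where the functional may be positive, still diverge.\<close>
    obtain \<tau> where \<tau>: "filterlim \<tau> at_top sequentially"
      "\<And>a C. a \<in> A - G \<Longrightarrow> filterlim (\<lambda>i. (lam i a + a \<bullet> y i - c i) + \<tau> i * C) at_bot sequentially"
      using slow_divergence[of "A - G" "\<lambda>i a. lam i a + a \<bullet> y i - c i"] A(1) y(2) by blast
    have eq: "lam i a + a \<bullet> (y i + \<tau> i *\<^sub>R h) - (c i + \<tau> i * k)
      = (lam i a + a \<bullet> y i - c i) + \<tau> i * (a \<bullet> h - k)" for i a
      by (simp add: inner_add_right algebra_simps)
    show ?thesis
    proof (intro exI[of _ "\<lambda>i. y i + \<tau> i *\<^sub>R h"] exI[of _ "\<lambda>i. c i + \<tau> i * k"] conjI allI ballI)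
      fix i a assume "a \<in> F"
      then show "lam i a + a \<bullet> (y i + \<tau> i *\<^sub>R h) = c i + \<tau> i * k"
        using eq[of i a] h_F y(1)[of a i] \<open>F \<subseteq> G\<close> by auto
    next
      fix a assume a: "a \<in> A - F"
      show "filterlim (\<lambda>i. lam i a + a \<bullet> (y i + \<tau> i *\<^sub>R h) - (c i + \<tau> i * k)) at_bot sequentially"
      proof (cases "a \<in> G")
        case True
        then have "filterlim (\<lambda>i. (a \<bullet> h - k) * \<tau> i) at_bot sequentially"
          using h_G a \<tau>(1) by (intro filterlim_tendsto_neg_mult_at_bot[OF tendsto_const]) auto
        moreover have "lam i a + a \<bullet> y i - c i = 0" for i using y(1)[OF True] by simp
        ultimately show ?thesis unfolding eq by (simp add: mult.commute)
      next
        case False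
        then show ?thesis unfolding eq using a \<tau>(2) by blast
      qed
    qed
  qed
  then show ?thesis
    using r(1) t lim asymp_in_S
    by (intro exI[of _ "r \<circ> t"] exI[of _ "lam 0"] exI[of _ lam] exI[of _ \<epsilon>])
      (auto simp: strict_mono_o S)
qed

section \<open>Toric varieties and Hausdorff distance\<close>

lemma monom_pt_eq_exp_inner:
  assumes "\<forall>j. 0 < x $ j"
  shows "monom_pt x a = exp (a \<bullet> (\<chi> j. ln (x $ j)))"
  by (simp add: monom_pt_def inner_vec_def exp_sum)

text \<open>Substituting y = ln x coordinatewise turns monomials into exponentials of linear forms
  and the positive orthant into a vector space, where parameters can be translated.\<close>

lemma monomial_points_eq_range:
  "{hom F (\<lambda>f. w f * monom_pt x f) | x. \<forall>j. 0 < x $ j} = range (\<lambda>y. hom F (\<lambda>f. w f * exp (f \<bullet> y)))"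
proof (intro set_eqI iffI)
  fix z assume "z \<in> {hom F (\<lambda>f. w f * monom_pt x f) | x. \<forall>j. 0 < x $ j}"
  then obtain x where x: "\<forall>j. 0 < x $ j" "z = hom F (\<lambda>f. w f * monom_pt x f)" by blast
  then have "z = hom F (\<lambda>f. w f * exp (f \<bullet> (\<chi> j. ln (x $ j))))" by (simp add: monom_pt_eq_exp_inner)
  then show "z \<in> range (\<lambda>y. hom F (\<lambda>f. w f * exp (f \<bullet> y)))" by blast
next
  fix z assume "z \<in> range (\<lambda>y. hom F (\<lambda>f. w f * exp (f \<bullet> y)))"
  then obtain y where z: "z = hom F (\<lambda>f. w f * exp (f \<bullet> y))" by blast
  define x :: "real^'a" where "x = (\<chi> j. exp (y $ j))"
  have x: "\<forall>j. 0 < x $ j" by (simp add: x_def)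
  then have "monom_pt x f = exp (f \<bullet> y)" for f
    by (simp add: monom_pt_eq_exp_inner) (simp add: x_def)
  then have "z = hom F (\<lambda>f. w f * monom_pt x f)" by (simp add: z)
  with x show "z \<in> {hom F (\<lambda>f. w f * monom_pt x f) | x. \<forall>j. 0 < x $ j}" by blast
qed

lemma l1dist_self [simp]: "l1dist A z z = 0"
  by (simp add: l1dist_def)

lemma l1dist_nonneg: "0 \<le> l1dist A x y"
  by (simp add: l1dist_def sum_nonneg)

lemma l1dist_commute: "l1dist A x y = l1dist A y x"
  by (simp add: l1dist_def abs_minus_commute)

lemma l1dist_triangle: "l1dist A x z \<le> l1dist A x y + l1dist A y z"
  unfolding l1dist_def sum.distrib[symmetric] by (intro sum_mono) auto

lemma l1dist_tendsto_0:
  assumes "\<And>a. a \<in> A \<Longrightarrow> (\<lambda>i. x i a - y i a) \<longlonglongrightarrow> 0"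
  shows "(\<lambda>i. l1dist A (x i) (y i)) \<longlonglongrightarrow> 0"
proof -
  have "(\<lambda>i. l1dist A (x i) (y i)) \<longlonglongrightarrow> (\<Sum>a\<in>A. \<bar>0::real\<bar>)"
    unfolding l1dist_def by (intro tendsto_sum tendsto_rabs assms)
  then show ?thesis by simp
qed

lemma toric_iff:
  "z \<in> toric A w F \<longleftrightarrow> z \<in> simplexA F \<and> (\<forall>e>0. \<exists>y. l1dist A z (hom F (\<lambda>f. w f * exp (f \<bullet> y))) < e)"
  unfolding toric_def monomial_points_eq_range by auto

lemma hom_in_simplexA:
  assumes "finite F" "F \<noteq> {}" "\<And>a. a \<in> F \<Longrightarrow> 0 < v a"
  shows "hom F v \<in> simplexA F"
proof -
  have "sum v F > 0" using assms by (intro sum_pos) auto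
  moreover have "sum (hom F v) F = (\<Sum>a\<in>F. v a / sum v F)" by (simp add: hom_def)
  ultimately show ?thesis using assms
    by (auto simp: simplexA_def hom_def sum_divide_distrib[symmetric] less_imp_le)
qed

lemma hom_in_toric:
  assumes "finite F" "F \<noteq> {}" "\<And>a. a \<in> F \<Longrightarrow> 0 < w a"
  shows "hom F (\<lambda>f. w f * exp (f \<bullet> y)) \<in> toric A w F"
  unfolding toric_iff using assms
  by (auto intro!: hom_in_simplexA exI[of _ y])

lemma hom_cong: "(\<And>a. a \<in> F \<Longrightarrow> u a = v a) \<Longrightarrow> hom F u = hom F v"
  unfolding hom_def by (auto cong: sum.cong)

lemma hom_scale:
  assumes "k \<noteq> 0"
  shows "hom F (\<lambda>a. k * v a) = hom F v"
  using assms by (auto simp: hom_def sum_distrib_left[symmetric])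

text \<open>The normalising constants of asymptotic faces are invisible in homogeneous
  coordinates.\<close>

lemma hom_exp_shift: "hom F (\<lambda>a. exp (f a - c)) = hom F (\<lambda>a. exp (f a))"
  using hom_scale[of "exp (-c)" F "\<lambda>a. exp (f a)"] by (simp add: exp_add[symmetric])

text \<open>Exponentials off \<open>G\<close> tend to 0, and those on the nonempty \<open>G\<close>
  keep the denominator positive in the limit. This is why asymptotic faces are the supports of limit
  points.\<close>

lemma tendsto_hom_exp:
  assumes "finite A" "G \<noteq> {}" "G \<subseteq> A" "\<And>a. a \<in> G \<Longrightarrow> (\<lambda>i. f i a) \<longlonglongrightarrow> l a"
    and "\<And>a. a \<in> A - G \<Longrightarrow> filterlim (\<lambda>i. f i a) at_bot sequentially"
  shows "(\<lambda>i. hom A (\<lambda>a. exp (f i a)) b) \<longlonglongrightarrow> hom G (\<lambda>a. exp (l a)) b"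
proof -
  define m where "m a = (if a \<in> G then exp (l a) else 0)" for a
  have lim: "(\<lambda>i. exp (f i a)) \<longlonglongrightarrow> m a" if "a \<in> A" for a
    using that assms(4,5) filterlim_compose[OF exp_at_bot, of "\<lambda>i. f i a" sequentially]
    by (auto simp: m_def intro!: tendsto_exp)
  have sum_m: "sum m A = (\<Sum>a\<in>G. exp (l a))"
    unfolding m_def using assms(1,3) by (simp add: sum.inter_restrict[symmetric] Int_absorb1)
  have "sum m A > 0"
    unfolding sum_m using assms(1-3) finite_subset by (intro sum_pos) auto
  then have *: "(\<lambda>i. exp (f i b) / (\<Sum>a\<in>A. exp (f i a))) \<longlonglongrightarrow> m b / sum m A" if "b \<in> A"
    using lim that by (intro tendsto_divide tendsto_sum) auto
  show ?thesis
  proof (cases "b \<in> A")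
    case True
    then show ?thesis using *[OF True] unfolding sum_m by (auto simp: hom_def m_def)
  next
    case False
    then show ?thesis using assms(3) by (auto simp: hom_def)
  qed
qed

lemma act_hom:
  assumes "sum m A \<noteq> 0"
  shows "act A u (hom A m) = hom A (\<lambda>a. u a * m a)"
proof -
  have "act A u (hom A m) = hom A (\<lambda>a. (1 / sum m A) * (u a * m a))"
    unfolding act_def by (rule hom_cong) (simp add: hom_def)
  then show ?thesis using assms hom_scale[of "1 / sum m A" A "\<lambda>a. u a * m a"] by simp
qed

lemma act_hom_exp:
  assumes "finite A" "A \<noteq> {}"
  shows "act A u (hom A (\<lambda>a. 1 * exp (a \<bullet> y))) = hom A (\<lambda>a. u a * exp (a \<bullet> y))"
proof -
  have "(\<Sum>a\<in>A. exp (a \<bullet> y)) > 0" using assms by (intro sum_pos) auto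
  then show ?thesis using act_hom[of "\<lambda>a. exp (a \<bullet> y)" A u] by simp
qed

lemma hom_exp_in_act_toric_var:
  assumes "finite A" "A \<noteq> {}"
  shows "hom A (\<lambda>a. u a * exp (a \<bullet> y)) \<in> act A u ` toric_var A"
proof -
  have "hom A (\<lambda>a. 1 * exp (a \<bullet> y)) \<in> toric_var A"
    unfolding toric_var_def using assms by (rule hom_in_toric) simp
  then show ?thesis unfolding act_hom_exp[OF assms, of u y, symmetric] by (rule imageI)
qed

text \<open>The closure is taken before the action, so torus points approximating \<open>z\<close>
  must be carried along by continuity of the action at \<open>z\<close>.\<close>

lemma act_toric_var_approx:
  assumes "finite A" "A \<noteq> {}" "\<And>a. a \<in> A \<Longrightarrow> 0 < u a" "x \<in> act A u ` toric_var A" "e > 0"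
  shows "\<exists>y. l1dist A x (hom A (\<lambda>a. u a * exp (a \<bullet> y))) < e"
proof -
  obtain z where z: "z \<in> toric A (\<lambda>_. 1) A" "x = act A u z"
    using assms(4) by (auto simp: toric_var_def)
  have "\<forall>n. \<exists>y. l1dist A z (hom A (\<lambda>a. 1 * exp (a \<bullet> y))) < inverse (real (Suc n))"
    using z(1) unfolding toric_iff by simp
  from choice[OF this] obtain y where
    y: "\<And>n. l1dist A z (hom A (\<lambda>a. 1 * exp (a \<bullet> y n))) < inverse (real (Suc n))" by blast
  define p where "p n = hom A (\<lambda>a. 1 * exp (a \<bullet> y n))" for n
  have p: "(\<lambda>n. p n a) \<longlonglongrightarrow> z a" if "a \<in> A" for a
  proof -
    have "\<bar>p n a - z a\<bar> \<le> inverse (real (Suc n))" for n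
    proof -
      have "\<bar>z a - p n a\<bar> \<le> l1dist A z (p n)"
        unfolding l1dist_def using assms(1) that by (intro member_le_sum) auto
      then show ?thesis using y[of n] by (simp add: p_def abs_minus_commute)
    qed
    then have "(\<lambda>n. p n a - z a) \<longlonglongrightarrow> 0"
      by (intro Lim_null_comparison[OF _ LIMSEQ_inverse_real_of_nat]) auto
    then show ?thesis by (simp add: LIM_zero_iff)
  qed
  have z_simplex: "\<forall>a\<in>A. 0 \<le> z a" "sum z A = 1" using z(1) by (auto simp: toric_def simplexA_def)
  \<comment> \<open>A positive coordinate of \<open>z\<close> makes the limiting denominator of the
    action nonzero.\<close>
  then obtain b where "b \<in> A" "z b > 0"
    by (metis less_eq_real_def sum.neutral zero_neq_one)
  then have "(\<Sum>a\<in>A. u a * z a) > 0"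
    using assms(1,3) z_simplex by (intro sum_pos2[of A b]) (auto intro: mult_nonneg_nonneg less_imp_le)
  then have "(\<lambda>n. (u a * p n a) / (\<Sum>a\<in>A. u a * p n a)) \<longlonglongrightarrow> (u a * z a) / (\<Sum>a\<in>A. u a * z a)" if "a \<in> A" for a
    using that p by (intro tendsto_divide tendsto_sum tendsto_mult tendsto_const) auto
  then have "(\<lambda>n. act A u (p n) a) \<longlonglongrightarrow> act A u z a" if "a \<in> A" for a
    using that by (simp add: act_def hom_def)
  then have "(\<lambda>n. act A u z a - act A u (p n) a) \<longlonglongrightarrow> 0" if "a \<in> A" for a
    using tendsto_diff[OF tendsto_const, of "\<lambda>n. act A u (p n) a" "act A u z a" sequentially "act A u z a"] that by simp
  then have "(\<lambda>n. l1dist A (act A u z) (act A u (p n))) \<longlonglongrightarrow> 0" by (rule l1dist_tendsto_0)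
  then have "\<forall>\<^sub>F n in sequentially. l1dist A (act A u z) (act A u (p n)) < e"
    using assms(5) by (rule order_tendstoD)
  then obtain n where "l1dist A (act A u z) (act A u (p n)) < e"
    using eventually_happens'[OF sequentially_bot] by blast
  then show ?thesis using act_hom_exp[OF assms(1,2)] by (auto simp: p_def z(2))
qed

section \<open>Hausdorff distance estimates\<close>

lemma abs_hdistA_le:
  assumes "\<And>x. x \<in> X \<Longrightarrow> \<exists>y\<in>Y. l1dist A x y \<le> e" "\<And>y. y \<in> Y \<Longrightarrow> \<exists>x\<in>X. l1dist A x y \<le> e" "e \<ge> 0"
  shows "\<bar>hdistA A X Y\<bar> \<le> e"
proof (cases "X = {} \<or> Y = {}")
  case True
  then show ?thesis using assms(3) by (auto simp: hdistA_def)
next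
  case False
  \<comment> \<open>Stated for a general \<open>d\<close> so that it covers both one-sided
    distances, the second with the arguments of \<open>l1dist\<close> exchanged.\<close>
  have half: "0 \<le> (SUP p\<in>P. INF q\<in>Q. d p q)" "(SUP p\<in>P. INF q\<in>Q. d p q) \<le> e"
    if PQ: "P \<noteq> {}" "Q \<noteq> {}" "\<And>p q. 0 \<le> d p q" "\<And>p. p \<in> P \<Longrightarrow> \<exists>q\<in>Q. d p q \<le> e"
    for P Q :: "((real^'a) \<Rightarrow> real) set" and d :: "_ \<Rightarrow> _ \<Rightarrow> real"
  proof -
    have le: "(INF q\<in>Q. d p q) \<le> e" if p: "p \<in> P" for p
    proof -
      obtain q where q: "q \<in> Q" "d p q \<le> e" using PQ(4)[OF p] by blast
      have "bdd_below (d p ` Q)" using PQ(3) by (intro bdd_belowI2)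
      then have "(INF q\<in>Q. d p q) \<le> d p q" using q(1) by (rule cINF_lower)
      then show ?thesis using q(2) by linarith
    qed
    obtain p where p: "p \<in> P" using PQ(1) by blast
    have "0 \<le> (INF q\<in>Q. d p q)" using PQ(2,3) by (intro cINF_greatest) auto
    also have "\<dots> \<le> (SUP p\<in>P. INF q\<in>Q. d p q)"
      using p le by (intro cSUP_upper bdd_aboveI2) auto
    finally show "0 \<le> (SUP p\<in>P. INF q\<in>Q. d p q)" .
    show "(SUP p\<in>P. INF q\<in>Q. d p q) \<le> e" using PQ(1) le by (rule cSUP_least)
  qed
  show ?thesis
    using half[of X Y "l1dist A"] half[of Y X "\<lambda>y x. l1dist A x y"] False assms
    by (auto simp: hdistA_def l1dist_nonneg)
qed

lemma toric_coords_bounded: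
  assumes "finite A" "F \<subseteq> A" "z \<in> toric A w F"
  shows "\<bar>z a\<bar> \<le> 1"
proof (cases "a \<in> F")
  case True
  have z: "\<forall>a\<in>F. 0 \<le> z a" "sum z F = 1" using assms(3) by (auto simp: toric_iff simplexA_def)
  then have "z a \<le> sum z F"
    using True finite_subset[OF assms(2,1)] by (intro member_le_sum) auto
  then show ?thesis using True z by simp
next
  case False
  then show ?thesis using assms(3) by (simp add: toric_iff simplexA_def)
qed

text \<open>By contradiction: torus points far from the complex along a subsequence concentrate,
  after further thinning, on an asymptotic face \<open>G\<close>, which lies in \<open>S\<close>.
  There they approach points of the stratum of \<open>G\<close>.\<close>

lemma deformed_toric_near_complex:
  fixes v lam :: "nat \<Rightarrow> (real^'d) \<Rightarrow> real"
  assumes A: "finite A" "A \<noteq> {}"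
    and lim: "\<And>a. a \<in> A \<Longrightarrow> (\<lambda>i. v i a - lam i a) \<longlonglongrightarrow> \<epsilon> a"
    and exact: "\<And>G. G \<in> S \<Longrightarrow> \<exists>y c. \<forall>i. \<forall>a\<in>G. lam i a + a \<bullet> y i = c i"
    and asymp: "\<And>s G. strict_mono s \<Longrightarrow> asymp_face A (\<lambda>i. v (s i)) G \<Longrightarrow> G \<in> S"
    and "e > 0"
  shows "\<forall>\<^sub>F i in sequentially. \<forall>y. \<exists>q\<in>toric_complex A S (\<lambda>a. exp (\<epsilon> a)).
    l1dist A (hom A (\<lambda>a. exp (v i a + a \<bullet> y))) q < e"
proof (rule ccontr)
  assume "\<not> ?thesis"
  from not_eventually_sequentiallyD[OF this] obtain s :: "nat \<Rightarrow> nat" where s: "strict_mono s"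
    "\<forall>n. \<exists>y. \<forall>q\<in>toric_complex A S (\<lambda>a. exp (\<epsilon> a)).
      \<not> l1dist A (hom A (\<lambda>a. exp (v (s n) a + a \<bullet> y))) q < e" by blast
  from choice[OF s(2)] obtain y where y: "\<And>n q. q \<in> toric_complex A S (\<lambda>a. exp (\<epsilon> a)) \<Longrightarrow>
      \<not> l1dist A (hom A (\<lambda>a. exp (v (s n) a + a \<bullet> y n))) q < e" by blast
  \<comment> \<open>Subtracting the maximum gives nonpositive exponents with a zero among them, as
    \<open>convergent_or_at_bot_subseq\<close> requires.\<close>
  define c where "c n = Max ((\<lambda>a. v (s n) a + a \<bullet> y n) ` A)" for n
  define f where "f n a = v (s n) a + a \<bullet> y n - c n" for n a
  have f_le: "f n a \<le> 0" if "a \<in> A" for n a using A that by (simp add: f_def c_def)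
  have f_0: "\<exists>a\<in>A. f n a = 0" for n
  proof -
    have "c n \<in> (\<lambda>a. v (s n) a + a \<bullet> y n) ` A" unfolding c_def using A by (intro Max_in) auto
    then show ?thesis by (auto simp: f_def)
  qed
  obtain s' G l where s': "strict_mono s'" and G: "G \<noteq> {}" "G \<subseteq> A"
    "\<And>a. a \<in> G \<Longrightarrow> (\<lambda>i. f (s' i) a) \<longlonglongrightarrow> l a"
    "\<And>a. a \<in> A - G \<Longrightarrow> filterlim (\<lambda>i. f (s' i) a) at_bot sequentially"
    using convergent_or_at_bot_subseq[of A f, OF A(1) f_le f_0] by blast
  define \<sigma> where "\<sigma> = s \<circ> s'"
  have \<sigma>: "strict_mono \<sigma>" using s(1) s' by (simp add: \<sigma>_def strict_mono_o)
  have "asymp_face A (\<lambda>i. v (\<sigma> i)) G"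
    unfolding asymp_face_def
  proof (intro conjI exI[of _ "\<lambda>i. y (s' i)"] exI[of _ "\<lambda>i. c (s' i)"] ballI)
    fix a assume "a \<in> G"
    then show "bounded (range (\<lambda>i. v (\<sigma> i) a + a \<bullet> y (s' i) - c (s' i)))"
      using convergent_imp_bounded[OF G(3)] by (simp add: f_def \<sigma>_def)
  qed (use G in \<open>auto simp: f_def \<sigma>_def\<close>)
  then have GS: "G \<in> S" using asymp[OF \<sigma>] by blast
  then obtain yG cG where yG: "\<And>i a. a \<in> G \<Longrightarrow> lam i a + a \<bullet> yG i = cG i"
    using exact by blast
  define P where "P i = hom A (\<lambda>a. exp (v (\<sigma> i) a + a \<bullet> y (s' i)))" for i
  \<comment> \<open>The comparison point in the stratum of \<open>G\<close>. Because
    \<open>lam\<close> is affine on \<open>G\<close>, translating the parameter by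
    \<open>- yG (\<sigma> i)\<close> removes it: on \<open>G\<close> the exponents of
    \<open>P i\<close> and \<open>Q i\<close> then differ by a common constant and a term tending to
    0.\<close>
  define Q where "Q i = hom G (\<lambda>a. exp (\<epsilon> a) * exp (a \<bullet> (y (s' i) - yG (\<sigma> i))))" for i
  define g where "g i a = \<epsilon> a + a \<bullet> (y (s' i) - yG (\<sigma> i)) - (c (s' i) - cG (\<sigma> i))" for i a
  have finG: "finite G" using A(1) G(2) finite_subset by blast
  have P: "P i = hom A (\<lambda>a. exp (f (s' i) a))" for i
    unfolding P_def f_def hom_exp_shift by (simp add: \<sigma>_def)
  have Q: "Q i = hom G (\<lambda>a. exp (g i a))" for i
    unfolding Q_def g_def hom_exp_shift by (simp add: exp_add)
  have g_lim: "(\<lambda>i. g i a) \<longlonglongrightarrow> l a" if "a \<in> G" for a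
  proof -
    have "g i a = f (s' i) a - (v (\<sigma> i) a - lam (\<sigma> i) a) + \<epsilon> a" for i
      using yG[OF that, of "\<sigma> i"] by (simp add: g_def f_def \<sigma>_def inner_diff_right)
    moreover have "(\<lambda>i. v (\<sigma> i) a - lam (\<sigma> i) a) \<longlonglongrightarrow> \<epsilon> a"
      using LIMSEQ_subseq_LIMSEQ[OF lim \<sigma>, of a] that G(2) by (auto simp: o_def)
    then have "(\<lambda>i. f (s' i) a - (v (\<sigma> i) a - lam (\<sigma> i) a) + \<epsilon> a) \<longlonglongrightarrow> l a - \<epsilon> a + \<epsilon> a"
      by (intro tendsto_add tendsto_diff G(3)[OF that] tendsto_const)
    ultimately show ?thesis by simp
  qed
  have "(\<lambda>i. P i a) \<longlonglongrightarrow> hom G (\<lambda>a. exp (l a)) a" for a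
    unfolding P using A(1) G by (rule tendsto_hom_exp)
  moreover have "(\<lambda>i. Q i a) \<longlonglongrightarrow> hom G (\<lambda>a. exp (l a)) a" for a
    unfolding Q by (rule tendsto_hom_exp[OF finG G(1) subset_refl g_lim]) auto
  ultimately have "(\<lambda>i. P i a - Q i a) \<longlonglongrightarrow> 0" for a
    using tendsto_diff[of "\<lambda>i. P i a" _ sequentially "\<lambda>i. Q i a"] by fastforce
  then have "(\<lambda>i. l1dist A (P i) (Q i)) \<longlonglongrightarrow> 0" by (rule l1dist_tendsto_0)
  then have "\<forall>\<^sub>F i in sequentially. l1dist A (P i) (Q i) < e"
    using \<open>e > 0\<close> by (rule order_tendstoD)
  then obtain i where i: "l1dist A (P i) (Q i) < e"
    using eventually_happens'[OF sequentially_bot] by blast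
  have "Q i \<in> toric A (\<lambda>a. exp (\<epsilon> a)) G"
    unfolding Q_def using finG G(1) by (rule hom_in_toric) simp
  then have "Q i \<in> toric_complex A S (\<lambda>a. exp (\<epsilon> a))"
    using GS by (auto simp: toric_complex_def)
  from y[OF this, of "s' i"] i show False by (simp add: P_def \<sigma>_def)
qed

text \<open>A torus point of the stratum with parameter \<open>h\<close> is reached by the
  parameters \<open>h + y i\<close>: on \<open>G\<close> the shift cancels \<open>lam\<close>,
  leaving \<open>\<epsilon> a + a \<bullet> h\<close>, and off \<open>G\<close> it forces
  divergence.\<close>

lemma toric_stratum_limit:
  fixes v lam :: "nat \<Rightarrow> (real^'d) \<Rightarrow> real"
  assumes A: "finite A" and G: "G \<noteq> {}" "G \<subseteq> A"
    and lim: "\<And>a. a \<in> A \<Longrightarrow> (\<lambda>i. v i a - lam i a) \<longlonglongrightarrow> \<epsilon> a"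
    and exact: "\<And>i a. a \<in> G \<Longrightarrow> lam i a + a \<bullet> y i = c i"
      "\<And>a. a \<in> A - G \<Longrightarrow> filterlim (\<lambda>i. lam i a + a \<bullet> y i - c i) at_bot sequentially"
    and z: "z \<in> toric A (\<lambda>a. exp (\<epsilon> a)) G" and "e > 0"
  shows "\<forall>\<^sub>F i in sequentially. \<exists>x. l1dist A (hom A (\<lambda>a. exp (v i a + a \<bullet> x))) z < e"
proof -
  obtain h where h: "l1dist A z (hom G (\<lambda>a. exp (\<epsilon> a) * exp (a \<bullet> h))) < e / 2"
    using z \<open>e > 0\<close> unfolding toric_iff by (meson half_gt_zero)
  define f where "f i a = v i a + a \<bullet> (h + y i) - c i" for i a
  define p where "p = hom G (\<lambda>a. exp (\<epsilon> a + a \<bullet> h))"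
  have f: "f i a = (lam i a + a \<bullet> y i - c i) + ((v i a - lam i a) + a \<bullet> h)" for i a
    by (simp add: f_def inner_add_right)
  have sum_lim: "(\<lambda>i. (v i a - lam i a) + a \<bullet> h) \<longlonglongrightarrow> \<epsilon> a + a \<bullet> h" if "a \<in> A" for a
    by (intro tendsto_add lim[OF that] tendsto_const)
  have "(\<lambda>i. hom A (\<lambda>a. exp (f i a)) b) \<longlonglongrightarrow> p b" for b
    unfolding p_def
  proof (rule tendsto_hom_exp[OF A G])
    fix a assume a: "a \<in> G"
    then have "f i a = (v i a - lam i a) + a \<bullet> h" for i using exact(1)[OF a, of i] by (simp add: f)
    then show "(\<lambda>i. f i a) \<longlonglongrightarrow> \<epsilon> a + a \<bullet> h" using sum_lim a G(2) by auto
  next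
    fix a assume a: "a \<in> A - G"
    then have "bounded (range (\<lambda>i. (v i a - lam i a) + a \<bullet> h))"
      using convergent_imp_bounded[OF sum_lim] by blast
    then show "filterlim (\<lambda>i. f i a) at_bot sequentially"
      unfolding f by (rule filterlim_at_bot_add_bounded[OF exact(2)[OF a]])
  qed
  then have "(\<lambda>i. hom A (\<lambda>a. exp (f i a)) b - p b) \<longlonglongrightarrow> 0" for b
    by (simp add: LIM_zero_iff)
  then have "(\<lambda>i. l1dist A (hom A (\<lambda>a. exp (f i a))) p) \<longlonglongrightarrow> 0"
    by (rule l1dist_tendsto_0)
  then have "\<forall>\<^sub>F i in sequentially. l1dist A (hom A (\<lambda>a. exp (f i a))) p < e / 2"
    using \<open>e > 0\<close> by (intro order_tendstoD) auto
  then show ?thesis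
  proof eventually_elim
    case (elim i)
    have "l1dist A z p < e / 2" using h by (simp add: p_def exp_add)
    then have "l1dist A (hom A (\<lambda>a. exp (f i a))) z < e"
      using elim l1dist_triangle[of A "hom A (\<lambda>a. exp (f i a))" z p] l1dist_commute[of A z p] by simp
    moreover have "hom A (\<lambda>a. exp (f i a)) = hom A (\<lambda>a. exp (v i a + a \<bullet> (h + y i)))"
      unfolding f_def hom_exp_shift ..
    ultimately show ?case by auto
  qed
qed

text \<open>Makes \<open>toric_stratum_limit\<close> uniform in the point \<open>z\<close>. Bad
  points along a subsequence would have a coordinatewise limit, so a single one of them stands in
  for all later ones.\<close>

lemma complex_near_deformed_toric:
  fixes v lam :: "nat \<Rightarrow> (real^'d) \<Rightarrow> real"
  assumes A: "finite A"
    and S: "\<And>G. G \<in> S \<Longrightarrow> G \<noteq> {} \<and> G \<subseteq> A"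
    and lim: "\<And>a. a \<in> A \<Longrightarrow> (\<lambda>i. v i a - lam i a) \<longlonglongrightarrow> \<epsilon> a"
    and exact: "\<And>G. G \<in> S \<Longrightarrow> \<exists>y c. (\<forall>i. \<forall>a\<in>G. lam i a + a \<bullet> y i = c i) \<and>
       (\<forall>a\<in>A - G. filterlim (\<lambda>i. lam i a + a \<bullet> y i - c i) at_bot sequentially)"
    and "e > 0"
  shows "\<forall>\<^sub>F i in sequentially. \<forall>z\<in>toric_complex A S (\<lambda>a. exp (\<epsilon> a)).
    \<exists>x. l1dist A (hom A (\<lambda>a. exp (v i a + a \<bullet> x))) z < e"
proof (rule ccontr)
  assume "\<not> ?thesis"
  from not_eventually_sequentiallyD[OF this] obtain s :: "nat \<Rightarrow> nat" where s: "strict_mono s"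
    "\<forall>n. \<exists>z. z \<in> toric_complex A S (\<lambda>a. exp (\<epsilon> a)) \<and>
      (\<forall>x. \<not> l1dist A (hom A (\<lambda>a. exp (v (s n) a + a \<bullet> x))) z < e)" by blast
  from choice[OF s(2)] obtain z where z: "\<And>n. z n \<in> toric_complex A S (\<lambda>a. exp (\<epsilon> a))"
    "\<And>n x. \<not> l1dist A (hom A (\<lambda>a. exp (v (s n) a + a \<bullet> x))) (z n) < e" by blast
  have "\<bar>z n a\<bar> \<le> 1" for n a
    using z(1)[of n] S toric_coords_bounded[OF A] unfolding toric_complex_def by blast
  then have "bounded (range (\<lambda>n. z n a))" for a by (intro boundedI[of _ 1]) auto
  then obtain s' l where s': "strict_mono s'" "\<And>a. a \<in> A \<Longrightarrow> (\<lambda>n. z (s' n) a) \<longlonglongrightarrow> l a"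
    using finite_bounded_convergent_subseq[OF A, of z] by blast
  have "(\<lambda>n. z (s' n) a - l a) \<longlonglongrightarrow> 0" if "a \<in> A" for a
    using s'(2)[OF that] by (simp add: LIM_zero_iff)
  then have "(\<lambda>n. l1dist A (z (s' n)) l) \<longlonglongrightarrow> 0" by (rule l1dist_tendsto_0)
  \<comment> \<open>Three errors of size \<open>e / 3\<close> are added below: from
    \<open>z (s' n)\<close> to \<open>l\<close>, from \<open>l\<close> to \<open>z (s' N)\<close>,
    and from there to a torus point.\<close>
  then have "\<forall>\<^sub>F n in sequentially. l1dist A (z (s' n)) l < e / 3"
    using \<open>e > 0\<close> by (intro order_tendstoD) auto
  then obtain N where N: "\<And>n. n \<ge> N \<Longrightarrow> l1dist A (z (s' n)) l < e / 3"
    by (auto simp: eventually_sequentially)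
  obtain G where G: "G \<in> S" "z (s' N) \<in> toric A (\<lambda>a. exp (\<epsilon> a)) G"
    using z(1)[of "s' N"] by (auto simp: toric_complex_def)
  obtain y c where "\<And>i a. a \<in> G \<Longrightarrow> lam i a + a \<bullet> y i = c i"
    "\<And>a. a \<in> A - G \<Longrightarrow> filterlim (\<lambda>i. lam i a + a \<bullet> y i - c i) at_bot sequentially"
    using exact[OF G(1)] by blast
  then have "\<forall>\<^sub>F i in sequentially. \<exists>x. l1dist A (hom A (\<lambda>a. exp (v i a + a \<bullet> x))) (z (s' N)) < e / 3"
    using S[OF G(1)] \<open>e > 0\<close> by (intro toric_stratum_limit[OF A _ _ lim _ _ G(2)]) auto
  then obtain M where M: "\<And>i. i \<ge> M \<Longrightarrow> \<exists>x. l1dist A (hom A (\<lambda>a. exp (v i a + a \<bullet> x))) (z (s' N)) < e / 3"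
    by (auto simp: eventually_sequentially)
  \<comment> \<open>\<open>n\<close> is at least \<open>N\<close> for closeness to \<open>l\<close>,
    and at least \<open>M\<close>, whence \<open>s (s' n)\<close> is also at least
    \<open>M\<close>.\<close>
  define n where "n = max M N"
  have "strict_mono (s \<circ> s')" using s(1) s'(1) by (rule strict_mono_o)
  then have "M \<le> s (s' n)"
    using seq_suble[of "s \<circ> s'" n] by (simp add: n_def)
  from M[OF this] obtain x where x: "l1dist A (hom A (\<lambda>a. exp (v (s (s' n)) a + a \<bullet> x))) (z (s' N)) < e / 3"
    by blast
  have "l1dist A (z (s' N)) (z (s' n)) < 2 * (e / 3)"
    using N[of N] N[of n] l1dist_triangle[of A "z (s' N)" "z (s' n)" l] l1dist_commute[of A "z (s' n)" l]
    by (simp add: n_def)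
  then have "l1dist A (hom A (\<lambda>a. exp (v (s (s' n)) a + a \<bullet> x))) (z (s' n)) < e"
    using x l1dist_triangle[of A "hom A (\<lambda>a. exp (v (s (s' n)) a + a \<bullet> x))" "z (s' n)" "z (s' N)"] by simp
  then show False using z(2) by blast
qed

section \<open>Convergence to the complex of toric varieties\<close>

theorem mainTheorem8:
  fixes A :: "(real^'d) set" and ws :: "nat \<Rightarrow> (real^'d \<Rightarrow> real)"
  assumes "finite A"
    and "\<forall>i. \<forall>a\<in>A. 0 < ws i a"
  shows "\<exists>r S w. strict_mono r \<and> is_regular_subdivision A S \<and> (\<forall>a\<in>A. 0 < w a) \<and>
     (\<lambda>j. hdistA A (act A (ws (r j)) ` toric_var A) (toric_complex A S w)) \<longlonglongrightarrow> 0"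
proof (cases "A = {}")
  \<comment> \<open>The simplex over the empty set is empty, as an empty sum is not 1, and
    \<open>hdistA\<close> takes the value 0 there.\<close>
  case True
  have "toric_var A = {}" by (simp add: True toric_var_def toric_def simplexA_def)
  then show ?thesis
    by (intro exI[of _ id] exI[of _ "reg_subdiv A (\<lambda>_. 0)"] exI[of _ "\<lambda>_. 1"])
      (auto simp: strict_mono_def is_regular_subdivision_def hdistA_def)
next
  case False
  note A = assms(1) False
  define v where "v i a = ln (ws i a)" for i a
  obtain r lam0 lam \<epsilon> where r: "strict_mono r"
    and *: "\<forall>a\<in>A. (\<lambda>i. v (r i) a - lam i a) \<longlonglongrightarrow> \<epsilon> a"
      "\<forall>G\<in>argmax_faces A lam0. \<exists>y c. (\<forall>i. \<forall>a\<in>G. lam i a + a \<bullet> y i = c i) \<and>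
         (\<forall>a\<in>A - G. filterlim (\<lambda>i. lam i a + a \<bullet> y i - c i) at_bot sequentially)"
      "\<forall>s G. strict_mono s \<longrightarrow> asymp_face A (\<lambda>i. v (r (s i))) G \<longrightarrow> G \<in> argmax_faces A lam0"
    using stable_exact_subdivision[OF A, of v] by (elim exE conjE) (rule that)
  note lim = bspec[OF *(1)] and exact = bspec[OF *(2)] and asymp = *(3)[rule_format]
  define S where "S = argmax_faces A lam0"
  define w where "w a = exp (\<epsilon> a)" for a
  define X where "X j = act A (ws (r j)) ` toric_var A" for j
  define Y where "Y = toric_complex A S w"
  have S: "G \<noteq> {} \<and> G \<subseteq> A" if "G \<in> S" for G
    using that argmax_faces_iff[OF A] unfolding S_def by blast
  have point: "hom A (\<lambda>a. exp (v (r j) a + a \<bullet> x)) = hom A (\<lambda>a. ws (r j) a * exp (a \<bullet> x))" for j x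
    using assms(2) by (intro hom_cong) (simp add: v_def exp_add)
  have "(\<lambda>j. hdistA A (X j) Y) \<longlonglongrightarrow> 0"
  proof (rule tendstoI)
    fix e :: real assume e: "e > 0"
    \<comment> \<open>One \<open>e / 4\<close> pays for approximating by a torus point and one for
      the two lemmas; the bound \<open>e / 2\<close> then leaves the strict inequality.\<close>
    then have e': "e / 4 > 0" by simp
    have "\<forall>\<^sub>F j in sequentially. \<forall>x. \<exists>q\<in>Y. l1dist A (hom A (\<lambda>a. exp (v (r j) a + a \<bullet> x))) q < e / 4"
      unfolding Y_def w_def
    proof (rule deformed_toric_near_complex[OF A lim _ _ e'])
      show "\<exists>y c. \<forall>i. \<forall>a\<in>G. lam i a + a \<bullet> y i = c i" if "G \<in> S" for G
        using exact that unfolding S_def by blast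
    qed (use asymp S_def in auto)
    moreover have "\<forall>\<^sub>F j in sequentially. \<forall>z\<in>Y. \<exists>x. l1dist A (hom A (\<lambda>a. exp (v (r j) a + a \<bullet> x))) z < e / 4"
      unfolding Y_def w_def
      by (rule complex_near_deformed_toric[OF A(1) S lim exact[folded S_def] e'])
    ultimately show "\<forall>\<^sub>F j in sequentially. dist (hdistA A (X j) Y) 0 < e"
    proof eventually_elim
      case (elim j)
      have "\<bar>hdistA A (X j) Y\<bar> \<le> e / 2"
      proof (rule abs_hdistA_le)
        fix x assume "x \<in> X j"
        then obtain y where y: "l1dist A x (hom A (\<lambda>a. ws (r j) a * exp (a \<bullet> y))) < e / 4"
          using act_toric_var_approx[OF A _ _ e', of "ws (r j)" x] assms(2) unfolding X_def by blast
        obtain q where "q \<in> Y" "l1dist A (hom A (\<lambda>a. ws (r j) a * exp (a \<bullet> y))) q < e / 4"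
          using elim(1) unfolding point by blast
        then show "\<exists>q\<in>Y. l1dist A x q \<le> e / 2"
          using y l1dist_triangle[of A x q "hom A (\<lambda>a. ws (r j) a * exp (a \<bullet> y))"]
          by (intro bexI[of _ q]) auto
      next
        fix q assume "q \<in> Y"
        then obtain y where "l1dist A (hom A (\<lambda>a. ws (r j) a * exp (a \<bullet> y))) q < e / 4"
          using elim(2) unfolding point by blast
        then show "\<exists>x\<in>X j. l1dist A x q \<le> e / 2"
          using hom_exp_in_act_toric_var[OF A, of "ws (r j)" y] e unfolding X_def
          by (intro bexI[of _ "hom A (\<lambda>a. ws (r j) a * exp (a \<bullet> y))"]) auto
      qed (use e in simp)
      then show ?case using e by simp
    qed
  qed
  moreover have "is_regular_subdivision A S"
    unfolding is_regular_subdivision_def S_def reg_subdiv_eq_argmax_faces[symmetric] by blast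
  ultimately show ?thesis using r unfolding X_def Y_def
    by (intro exI[of _ r] exI[of _ S] exI[of _ w]) (simp add: w_def)
qed

end
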